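(* Let $\alpha\in\,]0,\frac{\pi}{3}[$. For every integer $k\ge 0$ put $$D_k=\sin\frac{\alpha}{2^{k}}\,\sin\frac{2\alpha}{2^{k}}\,\sin\frac{3\alpha}{2^{k}}$$ and $$a^{(k)}_{0}=\frac{\sin^{3}\frac{\alpha}{2^{k+2}}}{D_k},$$ $$a^{(k)}_{1}=\frac{\sin\frac{3\alpha}{2^{k+2}}\sin^{2}\frac{5\alpha}{2^{k+2}}+\sin\frac{\alpha}{2^{k+2}}\sin\frac{5\alpha}{2^{k+2}}\sin\frac{7\alpha}{2^{k+2}}+\sin^{2}\frac{\alpha}{2^{k+2}}\sin\frac{11\alpha}{2^{k+2}}}{D_k},$$ $$a^{(k)}_{2}=\frac{\sin^{2}\frac{3\alpha}{2^{k+2}}\sin\frac{9\alpha}{2^{k+2}}+\sin\frac{3\alpha}{2^{k+2}}\sin\frac{5\alpha}{2^{k+2}}\sin\frac{7\alpha}{2^{k+2}}+\sin\frac{\alpha}{2^{k+2}}\sin^{2}\frac{7\alpha}{2^{k+2}}}{D_k},$$ $$a^{(k)}_{3}=\frac{\sin^{3}\frac{3\alpha}{2^{k+2}}}{D_k}.$$ Then the 4-point binary non-stationary subdivision scheme defined, for $k\ge 0$ and $i\in\mathbb{Z}$, by $$f^{k+1}_{2i}=a_{3}^{(k)}f^{k}_{i-1}+a_{2}^{(k)}f^{k}_{i}+a_{1}^{(k)}f^{k}_{i+1}+a_{0}^{(k)}f^{k}_{i+2},$$ $$f^{k+1}_{2i+1}=a_{0}^{(k)}f^{k}_{i-1}+a_{1}^{(k)}f^{k}_{i}+a_{2}^{(k)}f^{k}_{i+1}+a_{3}^{(k)}f^{k}_{i+2}$$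 converges and has smoothness $C^4$.
   Context: A binary non-stationary subdivision scheme starts from initial data $f^0=\{f_i^0\}_{i\in\mathbb{Z}}$ of real numbers and produces successively $f^{k+1}=\{f_i^{k+1}\}_{i\in\mathbb{Z}}$ from $f^k$, $k\ge 0$, by linear refinement rules whose coefficients (the mask) may depend on $k$. The scheme is said to converge and to have smoothness $C^m$ (to be $C^m$) if for every bounded initial data $f^0\in\ell^\infty(\mathbb{Z})$ there exists a limit function $g\in C^m(\mathbb{R})$ such that $\lim_{k\to\infty}\sup_{i\in\mathbb{Z}}|f_i^k-g(2^{-k}i)|=0$, and $g$ is not identically zero for some initial data $f^0$. *)

theory Defs
  imports "HOL-Analysis.Analysis"
begin

definition C_class :: "nat \<Rightarrow> (real \<Rightarrow> real) \<Rightarrow> bool" where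
  "C_class m g \<longleftrightarrow>
     (\<forall>j<m. (deriv ^^ j) g differentiable_on UNIV) \<and> continuous_on UNIV ((deriv ^^ m) g)"

text \<open>A binary non-stationary scheme is given by its refinement operators: \<open>S k\<close> maps the
  level-\<open>k\<close> data to the level-\<open>(k + 1)\<close> data.\<close>

type_synonym scheme = "nat \<Rightarrow> (int \<Rightarrow> real) \<Rightarrow> int \<Rightarrow> real"

primrec subdiv :: "scheme \<Rightarrow> (int \<Rightarrow> real) \<Rightarrow> nat \<Rightarrow> int \<Rightarrow> real" where
  "subdiv S f0 0 = f0"
| "subdiv S f0 (Suc k) = S k (subdiv S f0 k)"

text \<open>The supremum is taken in the extended reals, since a real \<open>SUP\<close> over an unbounded set
  would be an unspecified value.\<close>

definition subdiv_limit :: "scheme \<Rightarrow> (int \<Rightarrow> real) \<Rightarrow> (real \<Rightarrow> real) \<Rightarrow> bool" where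
  "subdiv_limit S f0 g \<longleftrightarrow>
     (\<lambda>k. SUP i::int. ereal \<bar>subdiv S f0 k i - g (real_of_int i / 2 ^ k)\<bar>) \<longlonglongrightarrow> 0"

definition converges_with_smoothness :: "nat \<Rightarrow> scheme \<Rightarrow> bool" where
  "converges_with_smoothness m S \<longleftrightarrow>
     (\<forall>f0. bounded (range f0) \<longrightarrow> (\<exists>g. C_class m g \<and> subdiv_limit S f0 g)) \<and>
     (\<exists>f0 g. bounded (range f0) \<and> C_class m g \<and> subdiv_limit S f0 g \<and> (\<exists>x. g x \<noteq> 0))"

definition D :: "real \<Rightarrow> nat \<Rightarrow> real" where
  "D \<alpha> k = sin (\<alpha> / 2 ^ k) * sin (2 * \<alpha> / 2 ^ k) * sin (3 * \<alpha> / 2 ^ k)"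

definition a0 :: "real \<Rightarrow> nat \<Rightarrow> real" where
  "a0 \<alpha> k = (sin (\<alpha> / 2 ^ (k + 2))) ^ 3 / D \<alpha> k"

definition a1 :: "real \<Rightarrow> nat \<Rightarrow> real" where
  "a1 \<alpha> k =
     (sin (3 * \<alpha> / 2 ^ (k + 2)) * (sin (5 * \<alpha> / 2 ^ (k + 2))) ^ 2
      + sin (\<alpha> / 2 ^ (k + 2)) * sin (5 * \<alpha> / 2 ^ (k + 2)) * sin (7 * \<alpha> / 2 ^ (k + 2))
      + (sin (\<alpha> / 2 ^ (k + 2))) ^ 2 * sin (11 * \<alpha> / 2 ^ (k + 2))) / D \<alpha> k"

definition a2 :: "real \<Rightarrow> nat \<Rightarrow> real" where
  "a2 \<alpha> k =
     ((sin (3 * \<alpha> / 2 ^ (k + 2))) ^ 2 * sin (9 * \<alpha> / 2 ^ (k + 2))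
      + sin (3 * \<alpha> / 2 ^ (k + 2)) * sin (5 * \<alpha> / 2 ^ (k + 2)) * sin (7 * \<alpha> / 2 ^ (k + 2))
      + sin (\<alpha> / 2 ^ (k + 2)) * (sin (7 * \<alpha> / 2 ^ (k + 2))) ^ 2) / D \<alpha> k"

definition a3 :: "real \<Rightarrow> nat \<Rightarrow> real" where
  "a3 \<alpha> k = (sin (3 * \<alpha> / 2 ^ (k + 2))) ^ 3 / D \<alpha> k"

text \<open>On \<open>int\<close>, \<open>div\<close> rounds towards minus infinity, so \<open>n div 2 = i\<close> for both \<open>n = 2 * i\<close> and
  \<open>n = 2 * i + 1\<close>, also for negative \<open>i\<close>; the two lemmas below are the refinement rules.\<close>

definition four_point_scheme :: "real \<Rightarrow> scheme" where
  "four_point_scheme \<alpha> k f n =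
     (let i = n div 2 in
      if even n
      then a3 \<alpha> k * f (i - 1) + a2 \<alpha> k * f i + a1 \<alpha> k * f (i + 1) + a0 \<alpha> k * f (i + 2)
      else a0 \<alpha> k * f (i - 1) + a1 \<alpha> k * f i + a2 \<alpha> k * f (i + 1) + a3 \<alpha> k * f (i + 2))"

lemma four_point_scheme_even:
  "four_point_scheme \<alpha> k f (2 * i) =
     a3 \<alpha> k * f (i - 1) + a2 \<alpha> k * f i + a1 \<alpha> k * f (i + 1) + a0 \<alpha> k * f (i + 2)"
  by (simp add: four_point_scheme_def)

lemma four_point_scheme_odd:
  "four_point_scheme \<alpha> k f (2 * i + 1) =
     a0 \<alpha> k * f (i - 1) + a1 \<alpha> k * f i + a2 \<alpha> k * f (i + 1) + a3 \<alpha> k * f (i + 2)"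
  by (simp add: four_point_scheme_def)

end

theory Submission
  imports Defs "HOL-Real_Asymp.Real_Asymp"
begin

text \<open>The mask, as a Laurent polynomial with coefficients
  \<open>a\<^sub>0, a\<^sub>3, a\<^sub>1, a\<^sub>2, a\<^sub>2, a\<^sub>1, a\<^sub>3, a\<^sub>0\<close> at the exponents \<open>-4, \<dots>, 3\<close>, is expanded as
  \<open>z^-4 (c\<^sub>0 (1 + z)^7 + c\<^sub>1 z (1 + z)^5 + c\<^sub>2 z^2 (1 + z)^3 + c\<^sub>3 z^3 (1 + z))\<close>. As \<open>k\<close> grows, \<open>c\<^sub>0\<close> and \<open>c\<^sub>1\<close>
  tend to \<open>1/384\<close> and \<open>20/384\<close> at rate \<open>4 ^ -k\<close>, while \<open>c\<^sub>2\<close> and \<open>c\<^sub>3\<close> are of order \<open>4 ^ -k\<close> and \<open>16 ^ -k\<close>.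
  A factor \<open>1 + z\<close> commutes with one difference operator and gains a factor \<open>1/2\<close>. Hence the first
  two terms make the \<open>j\<close>-th differences of the data decay like \<open>2 ^ -(j k)\<close> for \<open>j \<le> 4\<close>, and faster
  than \<open>16 ^ -k\<close> by a geometric factor for \<open>j = 5\<close> (the limiting contraction is \<open>22/384 < 1/16\<close>); the
  missing factors \<open>1 + z\<close> in the last two terms are paid for by the decay of \<open>c\<^sub>2\<close> and \<open>c\<^sub>3\<close>. So the
  scaled differences of orders \<open>0, \<dots>, 4\<close> converge uniformly to continuous functions, each of which is
  the derivative of the preceding one. For constant data the limit at \<open>0\<close> is an infinite product of the
  positive row sums \<open>1 + O(4 ^ -k)\<close>, hence nonzero.\<close>

section \<open>Difference operators and refinement\<close>

text \<open>On generating functions \<open>upsample\<close> is the substitution of z^2 for z, while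
  \<open>adjsum\<close> and \<open>bdiff\<close> are the multiplications by 1 + z and 1 - z.\<close>

definition upsample :: "(int \<Rightarrow> real) \<Rightarrow> int \<Rightarrow> real" where
  "upsample u m = (if even m then u (m div 2) else 0)"

definition adjsum :: "(int \<Rightarrow> real) \<Rightarrow> int \<Rightarrow> real" where
  "adjsum u m = u m + u (m - 1)"

definition bdiff :: "(int \<Rightarrow> real) \<Rightarrow> int \<Rightarrow> real" where
  "bdiff u m = u m - u (m - 1)"

lemma bdiff_adjsum: "bdiff (adjsum u) = adjsum (bdiff u)"
  by (simp add: fun_eq_iff bdiff_def adjsum_def)

lemma bdiff_adjsum_funpow: "bdiff ((adjsum ^^ n) u) = (adjsum ^^ n) (bdiff u)"
  by (induction n) (simp_all add: bdiff_adjsum)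

lemma adjsum_upsample: "adjsum (upsample u) m = u (m div 2)"
  by (cases "even m") (auto simp: adjsum_def upsample_def elim!: evenE oddE)

text \<open>(1 - z) (1 + z) = 1 - z^2: one factor 1 + z turns a fine-level difference into a
  coarse-level one.\<close>

lemma bdiff_adjsum_upsample: "bdiff (adjsum (upsample u)) = upsample (bdiff u)"
proof
  fix m :: int
  have "(2 * b - 1) div 2 = b - 1" for b :: int by presburger
  then show "bdiff (adjsum (upsample u)) m = upsample (bdiff u) m"
    by (cases "even m") (auto simp: adjsum_upsample bdiff_def upsample_def elim!: evenE oddE)
qed

lemma bdiff_refine: "bdiff ((adjsum ^^ Suc n) (upsample u)) = (adjsum ^^ n) (upsample (bdiff u))"
  by (metis bdiff_adjsum_funpow bdiff_adjsum_upsample funpow_Suc_right o_apply)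

lemma bdiff_funpow_refine:
  "(bdiff ^^ j) ((adjsum ^^ (j + n)) (upsample u)) = (adjsum ^^ n) (upsample ((bdiff ^^ j) u))"
proof (induction j arbitrary: u)
  case (Suc j)
  have "(bdiff ^^ Suc j) ((adjsum ^^ (Suc j + n)) (upsample u)) =
        (bdiff ^^ j) (bdiff ((adjsum ^^ Suc (j + n)) (upsample u)))"
    by (simp add: funpow_Suc_right del: funpow.simps)
  also have "\<dots> = (adjsum ^^ n) (upsample ((bdiff ^^ j) (bdiff u)))"
    by (simp only: bdiff_refine Suc.IH)
  finally show ?case
    by (simp add: funpow_Suc_right del: funpow.simps)
qed simp

lemma abs_bdiff_funpow_le:
  assumes "\<And>m. \<bar>u m\<bar> \<le> M"
  shows "\<bar>(bdiff ^^ j) u m\<bar> \<le> 2 ^ j * M"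
proof (induction j arbitrary: m)
  case (Suc j)
  have "\<bar>(bdiff ^^ Suc j) u m\<bar> \<le> \<bar>(bdiff ^^ j) u m\<bar> + \<bar>(bdiff ^^ j) u (m - 1)\<bar>"
    by (simp add: bdiff_def)
  with Suc.IH[of m] Suc.IH[of "m - 1"] show ?case by simp
qed (use assms in simp)

lemma abs_upsample_le:
  assumes "\<And>m. \<bar>u m\<bar> \<le> M"
  shows "\<bar>upsample u m\<bar> \<le> M"
  using assms[of "m div 2"] by (auto simp: upsample_def)

text \<open>The first \<open>adjsum\<close> costs nothing in the supremum norm, because of two
  adjacent upsampled entries one is zero; only the other \<open>n\<close> factors double the
  bound.\<close>

lemma abs_refine_le:
  assumes "\<And>m. \<bar>u m\<bar> \<le> M"
  shows "\<bar>(adjsum ^^ Suc n) (upsample u) m\<bar> \<le> 2 ^ n * M"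
proof (induction n arbitrary: m)
  case 0
  show ?case using assms by (simp add: adjsum_upsample)
next
  case (Suc n)
  have "\<bar>(adjsum ^^ Suc (Suc n)) (upsample u) m\<bar> \<le>
      \<bar>(adjsum ^^ Suc n) (upsample u) m\<bar> + \<bar>(adjsum ^^ Suc n) (upsample u) (m - 1)\<bar>"
    by (subst funpow.simps) (simp add: adjsum_def del: funpow.simps)
  with Suc.IH[of m] Suc.IH[of "m - 1"] show ?case by (simp del: funpow.simps)
qed

text \<open>Each further factor 1 + z doubles the data up to a first difference, and that difference
  is again a refinement, of \<open>bdiff u\<close>, with one factor fewer.\<close>

lemma refine_consistency:
  assumes "\<And>m. \<bar>bdiff u m\<bar> \<le> N"
  shows "\<bar>(adjsum ^^ Suc n) (upsample u) m - 2 ^ n * u (m div 2)\<bar> \<le> real n * 2 ^ n * N"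
proof (induction n)
  case 0
  show ?case by (simp add: adjsum_upsample)
next
  case (Suc n)
  define w where "w = (adjsum ^^ Suc n) (upsample u)"
  have "N \<ge> 0" using assms[of 0] by linarith
  have "\<bar>bdiff w m\<bar> \<le> 2 ^ n * N"
  proof (cases n)
    case 0
    then show ?thesis
      unfolding w_def bdiff_refine using abs_upsample_le[of "bdiff u", OF assms] by simp
  next
    case (Suc n')
    then have "\<bar>bdiff w m\<bar> \<le> 2 ^ n' * N"
      unfolding w_def bdiff_refine using abs_refine_le[of "bdiff u", OF assms] by blast
    also have "\<dots> \<le> 2 ^ n * N" using Suc \<open>N \<ge> 0\<close> by simp
    finally show ?thesis .
  qed
  moreover have "(adjsum ^^ Suc (Suc n)) (upsample u) m = 2 * w m - bdiff w m"
    by (subst funpow.simps) (simp add: w_def[symmetric] adjsum_def bdiff_def del: funpow.simps)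
  moreover have "\<bar>w m - 2 ^ n * u (m div 2)\<bar> \<le> real n * 2 ^ n * N"
    using Suc.IH by (simp add: w_def)
  ultimately show ?case using \<open>N \<ge> 0\<close> by (simp add: algebra_simps abs_le_iff)
qed

lemma abs_diff_le_bdiff:
  assumes "\<And>m. \<bar>bdiff u m\<bar> \<le> N"
  shows "\<bar>u (m + int n) - u m\<bar> \<le> real n * N"
proof (induction n)
  case (Suc n)
  from assms[of "m + int (Suc n)"] have "\<bar>u (m + int (Suc n)) - u (m + int n)\<bar> \<le> N"
    by (simp add: bdiff_def algebra_simps)
  with Suc show ?case by (simp add: algebra_simps)
qed simp

text \<open>The coefficients are those of the symbol
  \<open>c0 (1 + z)^7 + c1 z (1 + z)^5 + c2 z\<^sup>2 (1 + z)^3 + c3 z\<^sup>3 (1 + z)\<close>, shifted by \<open>z^-4\<close>.\<close>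
definition symop :: "real \<Rightarrow> real \<Rightarrow> real \<Rightarrow> real \<Rightarrow> (int \<Rightarrow> real) \<Rightarrow> int \<Rightarrow> real" where
  "symop c0 c1 c2 c3 u m =
     c0 * (adjsum ^^ 7) (upsample u) (m + 4) + c1 * (adjsum ^^ 5) (upsample u) (m + 3)
     + c2 * (adjsum ^^ 3) (upsample u) (m + 2) + c3 * adjsum (upsample u) (m + 1)"

lemma adjsum_expand:
  "(adjsum ^^ 2) w m = w m + 2 * w (m - 1) + w (m - 2)"
  "(adjsum ^^ 4) w m = w m + 4 * w (m - 1) + 6 * w (m - 2) + 4 * w (m - 3) + w (m - 4)"
  "(adjsum ^^ 6) w m = w m + 6 * w (m - 1) + 15 * w (m - 2) + 20 * w (m - 3) + 15 * w (m - 4)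
     + 6 * w (m - 5) + w (m - 6)"
  by (simp_all add: adjsum_def eval_nat_numeral)

text \<open>The mask is palindromic of length 8, and the polynomials z^i (1 + z)^(7 - 2 i), i = 0,
  ..., 3, span such masks. Their lowest exponents differ, so comparing the first four coefficients
  is a triangular system; solving it gives the arguments of \<open>symop\<close>.\<close>

lemma four_point_scheme_eq_symop:
  "four_point_scheme \<alpha> k =
     symop (a0 \<alpha> k) (a3 \<alpha> k - 7 * a0 \<alpha> k) (a1 \<alpha> k - 5 * a3 \<alpha> k + 14 * a0 \<alpha> k)
       (a2 \<alpha> k - 3 * a1 \<alpha> k + 5 * a3 \<alpha> k - 7 * a0 \<alpha> k)"
proof (intro ext)
  fix u :: "int \<Rightarrow> real" and m :: int
  define i where "i = m div 2"
  define r where "r = m mod 2"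
  have m: "m = 2 * i + r" and r: "r = 0 \<or> r = 1" by (auto simp: i_def r_def)
  have split: "(adjsum ^^ 7) w = (adjsum ^^ 6) (adjsum w)" "(adjsum ^^ 5) w = (adjsum ^^ 4) (adjsum w)"
      "(adjsum ^^ 3) w = (adjsum ^^ 2) (adjsum w)" for w
    by (simp_all add: eval_nat_numeral)
  have d: "(2 * i + 4) div 2 = i + 2" "(2 * i + 3) div 2 = i + 1" "(2 * i + 5) div 2 = i + 2"
    "(2 * i + 2) div 2 = i + 1" "(2 * i - 1) div 2 = i - 1" "(2 * i - 2) div 2 = i - 1"
    "(2 * i) div 2 = i" "(2 * i + 1) div 2 = i" by presburger+
  show "four_point_scheme \<alpha> k u m = symop (a0 \<alpha> k) (a3 \<alpha> k - 7 * a0 \<alpha> k) (a1 \<alpha> k - 5 * a3 \<alpha> k + 14 * a0 \<alpha> k)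
       (a2 \<alpha> k - 3 * a1 \<alpha> k + 5 * a3 \<alpha> k - 7 * a0 \<alpha> k) u m"
    using r
  proof
    assume "r = 0"
    then show ?thesis
      unfolding symop_def split adjsum_expand adjsum_upsample m
      by (simp add: four_point_scheme_def d) (simp add: algebra_simps)
  next
    assume "r = 1"
    then show ?thesis
      unfolding symop_def split adjsum_expand adjsum_upsample m
      by (simp add: four_point_scheme_def d) (simp add: algebra_simps)
  qed
qed

section \<open>Limits along dyadic grids\<close>

text \<open>A discrete Gronwall argument: \<open>b k + 1\<close> solves the recursion with equality,
  so it is a multiple of a product of factors \<open>1 + C * q ^ i\<close>, and 1 + t \<le> exp t
  with the geometric series bounds all these products at once. The 1 added to \<open>M\<close> in
  the step absorbs inhomogeneous terms.\<close>

lemma bounded_recursion: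
  fixes w :: "nat \<Rightarrow> int \<Rightarrow> real"
  assumes "0 \<le> C" "0 \<le> q" "q < 1"
    and init: "\<And>m. \<bar>w 0 m\<bar> \<le> M\<^sub>0"
    and step: "\<And>k M m. 0 \<le> M \<Longrightarrow> (\<And>m. \<bar>w k m\<bar> \<le> M) \<Longrightarrow> \<bar>w (Suc k) m\<bar> \<le> M + C * q ^ k * (M + 1)"
  obtains B where "\<And>k m. \<bar>w k m\<bar> \<le> B"
proof -
  define b where "b k = (M\<^sub>0 + 1) * (\<Prod>i<k. 1 + C * q ^ i) - 1" for k
  have "0 \<le> M\<^sub>0" using init[of 0] by linarith
  have "1 \<le> (\<Prod>i<k. 1 + C * q ^ i)" for k
    using assms(1,2) by (intro prod_ge_1) auto
  then have "(M\<^sub>0 + 1) * 1 \<le> (M\<^sub>0 + 1) * (\<Prod>i<k. 1 + C * q ^ i)" for k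
    using \<open>0 \<le> M\<^sub>0\<close> by (intro mult_left_mono) auto
  then have b_nonneg: "0 \<le> b k" for k
    using \<open>0 \<le> M\<^sub>0\<close> unfolding b_def by (smt (verit) mult.right_neutral)
  have w_le: "\<bar>w k m\<bar> \<le> b k" for k m
  proof (induction k arbitrary: m)
    case 0
    show ?case using init by (simp add: b_def)
  next
    case (Suc k)
    have "\<bar>w (Suc k) m\<bar> \<le> b k + C * q ^ k * (b k + 1)"
      by (rule step[OF b_nonneg Suc.IH])
    also have "\<dots> = b (Suc k)"
      by (simp add: b_def algebra_simps)
    finally show ?case .
  qed
  have "b k \<le> (M\<^sub>0 + 1) * exp (C / (1 - q)) - 1" for k
  proof -
    have "(\<Prod>i<k. 1 + C * q ^ i) \<le> (\<Prod>i<k. exp (C * q ^ i))"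
      using assms(1,2) by (intro prod_mono) auto
    also have "\<dots> = exp (C * (\<Sum>i<k. q ^ i))"
      by (simp add: exp_sum sum_distrib_left)
    also have "(\<Sum>i<k. q ^ i) \<le> 1 / (1 - q)"
    proof -
      have "(\<Sum>i<k. q ^ i) = (1 - q ^ k) / (1 - q)"
        using assms(3) by (simp add: sum_gp_strict)
      also have "\<dots> \<le> 1 / (1 - q)"
        using assms(2,3) by (intro divide_right_mono) auto
      finally show ?thesis .
    qed
    then have "exp (C * (\<Sum>i<k. q ^ i)) \<le> exp (C / (1 - q))"
      using assms(1) mult_left_mono[of "\<Sum>i<k. q ^ i" "1 / (1 - q)" C] by simp
    finally show ?thesis
      using \<open>0 \<le> M\<^sub>0\<close> by (simp add: b_def mult_left_mono)
  qed
  with w_le have "\<bar>w k m\<bar> \<le> (M\<^sub>0 + 1) * exp (C / (1 - q)) - 1" for k m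
    using order_trans by blast
  then show thesis by (rule that)
qed

text \<open>When the level-\<open>n\<close> data are read as a step function \<open>s n\<close> on
  dyadic intervals, \<open>refine\<close> bounds the uniform distance of consecutive step functions
  and \<open>neighbour\<close> their jumps. So they converge uniformly and the limit is
  continuous.\<close>

lemma dyadic_limit:
  fixes w :: "nat \<Rightarrow> int \<Rightarrow> real"
  assumes "0 \<le> \<theta>" "\<theta> < 1"
    and refine: "\<And>k m. \<bar>w (Suc k) m - w k (m div 2)\<bar> \<le> C * \<theta> ^ k"
    and neighbour: "\<And>k m. \<bar>w k m - w k (m - 1)\<bar> \<le> C * \<theta> ^ k"
  obtains g where "continuous_on UNIV g"
    "\<And>k i. \<bar>w k i - g (real_of_int i / 2 ^ k)\<bar> \<le> C / (1 - \<theta>) * \<theta> ^ k"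
proof -
  define s where "s n x = w n \<lfloor>2 ^ n * x\<rfloor>" for n :: nat and x :: real
  define d where "d x n = s (Suc n) x - s n x" for n x
  have d_le: "\<bar>d x n\<bar> \<le> C * \<theta> ^ n" for n x
  proof -
    \<comment> \<open>The level-\<open>n\<close> cell containing x is the parent of the
      level-\<open>Suc n\<close> one, and \<open>div 2\<close> maps child to parent.\<close>
    have "\<lfloor>2 ^ n * x\<rfloor> = \<lfloor>2 ^ Suc n * x\<rfloor> div 2"
      using floor_divide_real_eq_div[of 2 "2 ^ Suc n * x"] by simp
    then show ?thesis using refine[of n "\<lfloor>2 ^ Suc n * x\<rfloor>"] by (simp add: d_def s_def)
  qed
  have geom: "summable (\<lambda>i. C * \<theta> ^ (i + n))" for n
    using summable_mult[OF summable_geometric[of \<theta>], of "C * \<theta> ^ n"] assms(1,2)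
    by (simp add: power_add mult_ac)
  have geom_sum: "(\<Sum>i. C * \<theta> ^ (i + n)) = C / (1 - \<theta>) * \<theta> ^ n" for n
    using assms(1,2) suminf_mult[of "\<lambda>i. \<theta> ^ i" "C * \<theta> ^ n"] suminf_geometric[of \<theta>]
      summable_geometric[of \<theta>] by (simp add: power_add mult_ac)
  have summable_d: "summable (\<lambda>i. \<bar>d x (i + n)\<bar>)" for x n
    by (rule summable_comparison_test'[OF geom[of n], of 0]) (use d_le in simp)
  define g where "g x = s 0 x + (\<Sum>i. d x i)" for x
  have g_s: "\<bar>s n x - g x\<bar> \<le> C / (1 - \<theta>) * \<theta> ^ n" for n x
  proof -
    have "summable (d x)" using summable_rabs_cancel[of "d x"] summable_d[of x 0] by simp
    then have "(\<Sum>i. d x i) = (\<Sum>i. d x (i + n)) + (\<Sum>i<n. d x i)"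
      by (rule suminf_split_initial_segment)
    moreover have "(\<Sum>i<n. d x i) = s n x - s 0 x"
      unfolding d_def by (rule sum_lessThan_telescope)
    ultimately have "\<bar>s n x - g x\<bar> = \<bar>\<Sum>i. d x (i + n)\<bar>" by (simp add: g_def)
    also have "\<dots> \<le> (\<Sum>i. \<bar>d x (i + n)\<bar>)"
      by (rule summable_rabs[OF summable_d])
    also have "\<dots> \<le> (\<Sum>i. C * \<theta> ^ (i + n))"
      by (rule suminf_le[OF d_le summable_d geom])
    finally show ?thesis by (simp add: geom_sum)
  qed
  have "\<bar>w k i - g (real_of_int i / 2 ^ k)\<bar> \<le> C / (1 - \<theta>) * \<theta> ^ k" for k i
    using g_s[of k "real_of_int i / 2 ^ k"] by (simp add: s_def)
  moreover have "continuous_on UNIV g"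
  proof -
    \<comment> \<open>Twice the distance to \<open>s n\<close>, plus one jump of \<open>s n\<close>:
      points closer than \<open>1 / 2 ^ n\<close> lie in equal or adjacent cells.\<close>
    define K where "K = 2 * (C / (1 - \<theta>)) + C"
    have close: "\<bar>g x - g y\<bar> \<le> K * \<theta> ^ n" if "\<bar>x - y\<bar> < 1 / 2 ^ n" for x y :: real and n
    proof -
      have "\<bar>2 ^ n * x - 2 ^ n * y\<bar> < 1"
        using that by (simp add: field_simps abs_less_iff)
      then have "\<lfloor>2 ^ n * x\<rfloor> = \<lfloor>2 ^ n * y\<rfloor> \<or> \<lfloor>2 ^ n * x\<rfloor> = \<lfloor>2 ^ n * y\<rfloor> - 1 \<or> \<lfloor>2 ^ n * y\<rfloor> = \<lfloor>2 ^ n * x\<rfloor> - 1"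
        by linarith
      moreover have "0 \<le> C * \<theta> ^ n" using neighbour[of n 0] by linarith
      ultimately have "\<bar>s n x - s n y\<bar> \<le> C * \<theta> ^ n"
        using neighbour[of n "\<lfloor>2 ^ n * x\<rfloor>"] neighbour[of n "\<lfloor>2 ^ n * y\<rfloor>"]
        by (auto simp: s_def abs_minus_commute)
      with g_s[of n x] g_s[of n y] show ?thesis
        unfolding K_def distrib_right mult.assoc[of 2] by linarith
    qed
    have "(\<lambda>n. K * \<theta> ^ n) \<longlonglongrightarrow> 0"
      using assms(1,2) by (intro tendsto_mult_right_zero LIMSEQ_realpow_zero) auto
    show ?thesis
      unfolding continuous_on_iff
    proof (intro ballI allI impI)
      fix x e :: real assume "0 < e"
      from order_tendstoD(2)[OF \<open>(\<lambda>n. K * \<theta> ^ n) \<longlonglongrightarrow> 0\<close> this] obtain n where "K * \<theta> ^ n < e"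
        by (auto simp: eventually_sequentially)
      then have "\<bar>g y - g x\<bar> < e" if "\<bar>y - x\<bar> < 1 / 2 ^ n" for y
        using close[OF that] by linarith
      then show "\<exists>\<delta>>0. \<forall>y\<in>UNIV. dist y x < \<delta> \<longrightarrow> dist (g y) (g x) < e"
        by (intro exI[of _ "1 / 2 ^ n"]) (simp add: dist_real_def)
    qed
  qed
  ultimately show thesis using that by blast
qed

section \<open>Limits of divided differences as derivatives\<close>

lemma abs_telescope_le:
  fixes v :: "int \<Rightarrow> real"
  assumes "i \<le> j" and "\<And>l. i < l \<Longrightarrow> l \<le> j \<Longrightarrow> \<bar>v l - v (l - 1) - c\<bar> \<le> e"
  shows "\<bar>v j - v i - real_of_int (j - i) * c\<bar> \<le> e * real_of_int (j - i)"
  using assms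
proof (induction j rule: int_ge_induct)
  case (step j)
  have "\<bar>v j - v i - real_of_int (j - i) * c\<bar> \<le> e * real_of_int (j - i)"
    using step by simp
  moreover have "\<bar>v (j + 1) - v j - c\<bar> \<le> e"
    using step.prems[of "j + 1"] step.hyps by simp
  ultimately have "\<bar>v j - v i - real_of_int (j - i) * c + (v (j + 1) - v j - c)\<bar> \<le> e * real_of_int (j - i) + e"
    by linarith
  then show ?case by (simp add: algebra_simps)
qed simp

lemma dyadic_limit_floor:
  fixes w :: "nat \<Rightarrow> int \<Rightarrow> real"
  assumes "continuous_on UNIV g" "e \<longlonglongrightarrow> 0"
    and w: "\<And>k i. \<bar>w k i - g (real_of_int i / 2 ^ k)\<bar> \<le> e k"
  shows "(\<lambda>k. w k \<lfloor>2 ^ k * x\<rfloor>) \<longlonglongrightarrow> g x"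
    and "(\<lambda>k. real_of_int \<lfloor>2 ^ k * x\<rfloor> / 2 ^ k) \<longlonglongrightarrow> x"
proof -
  show lim: "(\<lambda>k. real_of_int \<lfloor>2 ^ k * x\<rfloor> / 2 ^ k) \<longlonglongrightarrow> x"
    by real_asymp
  have "isCont g x" using assms(1) by (simp add: continuous_on_eq_continuous_at)
  from isCont_tendsto_compose[OF this lim]
  have "(\<lambda>k. g (real_of_int \<lfloor>2 ^ k * x\<rfloor> / 2 ^ k)) \<longlonglongrightarrow> g x" .
  moreover have "(\<lambda>k. w k \<lfloor>2 ^ k * x\<rfloor> - g (real_of_int \<lfloor>2 ^ k * x\<rfloor> / 2 ^ k)) \<longlonglongrightarrow> 0"
    by (rule tendsto_0_le[OF assms(2), of _ 1])
      (auto intro!: always_eventually order_trans[OF w])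
  ultimately show "(\<lambda>k. w k \<lfloor>2 ^ k * x\<rfloor>) \<longlonglongrightarrow> g x"
    using tendsto_add by fastforce
qed

text \<open>The mean value estimate is made on the grid, before passing to the limit: an increment
  of \<open>w n\<close> is a sum of single differences, each close to \<open>h y / 2 ^ n\<close>
  when its grid point is near y.\<close>

lemma dyadic_limit_deriv:
  fixes w :: "nat \<Rightarrow> int \<Rightarrow> real"
  assumes cont: "continuous_on UNIV g" "continuous_on UNIV h"
    and e: "e \<longlonglongrightarrow> 0" "e' \<longlonglongrightarrow> 0"
    and g: "\<And>k i. \<bar>w k i - g (real_of_int i / 2 ^ k)\<bar> \<le> e k"
    and h: "\<And>k i. \<bar>2 ^ k * (w k i - w k (i - 1)) - h (real_of_int i / 2 ^ k)\<bar> \<le> e' k"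
  shows "(g has_real_derivative h y) (at y)"
proof -
  \<comment> \<open>One \<epsilon> is the oscillation of \<open>h\<close> on [a, b], the other
    bounds the error \<open>e' n\<close>.\<close>
  have increment: "\<bar>g b - g a - (b - a) * h y\<bar> \<le> 2 * \<epsilon> * (b - a)"
    if "a \<le> b" "0 < \<epsilon>" and near: "\<And>t. a \<le> t \<Longrightarrow> t \<le> b \<Longrightarrow> \<bar>h t - h y\<bar> \<le> \<epsilon>" for a b \<epsilon>
  proof -
    define i j where "i n = \<lfloor>2 ^ n * a\<rfloor>" and "j n = \<lfloor>2 ^ n * b\<rfloor>" for n :: nat
    define I J where "I n = real_of_int (i n) / 2 ^ n" and "J n = real_of_int (j n) / 2 ^ n" for n
    have "\<bar>w n (j n) - w n (i n) - (J n - I n) * h y\<bar> \<le> 2 * \<epsilon> * (J n - I n)"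
      if "e' n < \<epsilon>" for n
    proof -
      have "i n \<le> j n" using \<open>a \<le> b\<close> by (simp add: i_def j_def floor_mono)
      \<comment> \<open>Backward differences fit here: for \<open>i n < l\<close> the point
        \<open>l / 2 ^ n\<close> lies in (a, b], although \<open>I n\<close> may lie to the left of
        a.\<close>
      moreover have "\<bar>w n l - w n (l - 1) - h y / 2 ^ n\<bar> \<le> 2 * \<epsilon> / 2 ^ n" if "i n < l" "l \<le> j n" for l
      proof -
        have "2 ^ n * a < real_of_int l" "real_of_int l \<le> 2 ^ n * b"
          using that by (simp_all add: i_def j_def floor_less_iff le_floor_iff)
        then have "\<bar>h (real_of_int l / 2 ^ n) - h y\<bar> \<le> \<epsilon>"
          by (intro near) (simp_all add: field_simps)
        with h[of n l] \<open>e' n < \<epsilon>\<close> have "\<bar>2 ^ n * (w n l - w n (l - 1)) - h y\<bar> \<le> 2 * \<epsilon>"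
          by linarith
        then show ?thesis by (simp add: field_simps abs_le_iff)
      qed
      ultimately have "\<bar>w n (j n) - w n (i n) - real_of_int (j n - i n) * (h y / 2 ^ n)\<bar>
          \<le> 2 * \<epsilon> / 2 ^ n * real_of_int (j n - i n)"
        by (rule abs_telescope_le)
      moreover have "J n - I n = real_of_int (j n - i n) / 2 ^ n"
        by (simp add: I_def J_def diff_divide_distrib)
      ultimately show ?thesis by (simp add: mult.commute)
    qed
    then have "\<forall>\<^sub>F n in sequentially. \<bar>w n (j n) - w n (i n) - (J n - I n) * h y\<bar> \<le> 2 * \<epsilon> * (J n - I n)"
      using order_tendstoD(2)[OF e(2) \<open>0 < \<epsilon>\<close>] by (rule eventually_mono[rotated])
    moreover have "(\<lambda>n. \<bar>w n (j n) - w n (i n) - (J n - I n) * h y\<bar>) \<longlonglongrightarrow> \<bar>g b - g a - (b - a) * h y\<bar>"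
      and "(\<lambda>n. 2 * \<epsilon> * (J n - I n)) \<longlonglongrightarrow> 2 * \<epsilon> * (b - a)"
      unfolding i_def j_def I_def J_def
      by (intro tendsto_intros dyadic_limit_floor[OF cont(1) e(1) g])+
    ultimately show ?thesis
      by (intro tendsto_le[OF sequentially_bot]) auto
  qed
  show ?thesis
    unfolding has_field_derivative_def has_derivative_at_alt
  proof (intro conjI allI impI)
    fix \<epsilon> :: real assume "0 < \<epsilon>"
    then have "0 < \<epsilon> / 2" by simp
    moreover have "isCont h y" using cont(2) by (simp add: continuous_on_eq_continuous_at)
    ultimately obtain \<delta> where "0 < \<delta>" and \<delta>: "\<And>t. \<bar>t - y\<bar> < \<delta> \<Longrightarrow> \<bar>h t - h y\<bar> < \<epsilon> / 2"
      unfolding continuous_at_eps_delta dist_real_def by metis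
    have "\<bar>g x - g y - h y * (x - y)\<bar> \<le> \<epsilon> * \<bar>x - y\<bar>" if "\<bar>x - y\<bar> < \<delta>" for x
    proof (cases "y \<le> x")
      case True
      have "\<bar>g x - g y - (x - y) * h y\<bar> \<le> 2 * (\<epsilon> / 2) * (x - y)"
        using True \<delta> that \<open>0 < \<epsilon>\<close> by (intro increment) (auto intro: less_imp_le)
      with True show ?thesis by (simp add: mult.commute)
    next
      case False
      have "\<bar>g y - g x - (y - x) * h y\<bar> \<le> 2 * (\<epsilon> / 2) * (y - x)"
        using False \<delta> that \<open>0 < \<epsilon>\<close> by (intro increment) (auto intro: less_imp_le)
      with False show ?thesis by (simp add: algebra_simps abs_le_iff)
    qed
    with \<open>0 < \<delta>\<close> show "\<exists>d>0. \<forall>x. norm (x - y) < d \<longrightarrow> norm (g x - g y - h y * (x - y)) \<le> \<epsilon> * norm (x - y)"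
      by (auto simp: real_norm_def)
  qed (rule bounded_linear_mult_right)
qed

lemma C_class_chain:
  assumes "\<And>j y. j < m \<Longrightarrow> (G j has_real_derivative G (Suc j) y) (at y)"
    and "continuous_on UNIV (G m)"
  shows "C_class m (G 0)"
proof -
  have *: "(deriv ^^ j) (G 0) = G j" if "j \<le> m" for j
    using that
  proof (induction j)
    case (Suc j)
    then show ?case using assms(1)[of j] by (auto intro!: DERIV_imp_deriv)
  qed simp
  show ?thesis
    unfolding C_class_def
  proof (intro conjI allI impI)
    fix j assume "j < m"
    then show "(deriv ^^ j) (G 0) differentiable_on UNIV"
      using assms(1)[of j] *[of j]
      by (auto simp: differentiable_on_def intro!: differentiableI has_field_derivative_imp_has_derivative)
  qed (use assms(2) * in auto)
qed

section \<open>Decay of differences\<close>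

lemma bdiff_funpow_symop:
  "(bdiff ^^ j) (symop c0 c1 c2 c3 u) m =
     c0 * (bdiff ^^ j) ((adjsum ^^ 7) (upsample u)) (m + 4)
     + c1 * (bdiff ^^ j) ((adjsum ^^ 5) (upsample u)) (m + 3)
     + c2 * (bdiff ^^ j) ((adjsum ^^ 3) (upsample u)) (m + 2)
     + c3 * (bdiff ^^ j) (adjsum (upsample u)) (m + 1)"
proof (induction j arbitrary: m)
  case 0
  show ?case by (simp add: symop_def)
next
  case (Suc j)
  have expand: "(bdiff ^^ Suc j) v m = (bdiff ^^ j) v m - (bdiff ^^ j) v (m - 1)" for v m
    by (simp add: bdiff_def)
  show ?case
    by (simp add: expand Suc.IH algebra_simps del: funpow.simps)
qed

text \<open>At most \<open>Suc n\<close> differences can be traded for factors 1 + z. Each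
  difference or factor left over at most doubles the bound; \<open>2 ^ (n + j)\<close> is a crude
  count that covers both cases.\<close>

lemma abs_bdiff_funpow_refine_le:
  assumes "\<And>m. \<bar>(bdiff ^^ (min j (Suc n))) u m\<bar> \<le> M"
  shows "\<bar>(bdiff ^^ j) ((adjsum ^^ Suc n) (upsample u)) m\<bar> \<le> 2 ^ (n + j) * M"
proof -
  have M: "0 \<le> M" using assms[of 0] by linarith
  have *: "2 ^ p * M \<le> 2 ^ (n + j) * M" if "p \<le> n + j" for p
    using that M by (intro mult_right_mono power_increasing) auto
  show ?thesis
  proof (cases "j \<le> n")
    case True
    then obtain p where p: "n = j + p" using le_Suc_ex by blast
    have "\<bar>(adjsum ^^ Suc p) (upsample ((bdiff ^^ j) u)) m\<bar> \<le> 2 ^ p * M"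
      using assms p by (intro abs_refine_le) simp
    then show ?thesis
      using *[of p] p bdiff_funpow_refine[of j "Suc p" u] by (simp del: funpow.simps)
  next
    case False
    then obtain p where p: "j = p + Suc n" using le_Suc_ex[of "Suc n" j] by (auto simp: add.commute)
    then have min: "min j (Suc n) = Suc n" by simp
    have "\<bar>(bdiff ^^ p) (upsample ((bdiff ^^ Suc n) u)) m\<bar> \<le> 2 ^ p * M"
      using assms unfolding min by (intro abs_bdiff_funpow_le abs_upsample_le)
    moreover have "(bdiff ^^ j) ((adjsum ^^ Suc n) (upsample u)) = (bdiff ^^ p) (upsample ((bdiff ^^ Suc n) u))"
      using bdiff_funpow_refine[of "Suc n" 0 u] unfolding p funpow_add o_apply by (simp del: funpow.simps)
    ultimately show ?thesis
      using *[of p] p by (simp del: funpow.simps)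
  qed
qed

text \<open>The factors \<open>z\<^sup>2 (1 + z)^3\<close> and \<open>z\<^sup>3 (1 + z)\<close> only absorb three differences and one
  difference, so higher differences of these two terms are bounded by \<open>P\<close> and \<open>Q\<close>.\<close>
lemma symop_principal_part:
  assumes "j \<le> 5"
    and P: "\<And>m. \<bar>(bdiff ^^ (min j 3)) u m\<bar> \<le> P"
    and Q: "\<And>m. \<bar>(bdiff ^^ (min j 1)) u m\<bar> \<le> Q"
  shows "\<bar>(bdiff ^^ j) (symop c0 c1 c2 c3 u) m
      - c0 * (adjsum ^^ (7 - j)) (upsample ((bdiff ^^ j) u)) (m + 4)
      - c1 * (adjsum ^^ (5 - j)) (upsample ((bdiff ^^ j) u)) (m + 3)\<bar>
    \<le> 128 * \<bar>c2\<bar> * P + 32 * \<bar>c3\<bar> * Q"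
proof -
  have nonneg: "0 \<le> P" "0 \<le> Q" using P[of 0] Q[of 0] by linarith+
  have "\<bar>(bdiff ^^ j) ((adjsum ^^ 3) (upsample u)) (m + 2)\<bar> \<le> 2 ^ (2 + j) * P"
    using abs_bdiff_funpow_refine_le[of j 2 u P] P by (simp add: numeral_3_eq_3 numeral_2_eq_2)
  also have "\<dots> \<le> 2 ^ 7 * P"
    using assms(1) nonneg by (intro mult_right_mono power_increasing) auto
  finally have 1: "\<bar>c2 * (bdiff ^^ j) ((adjsum ^^ 3) (upsample u)) (m + 2)\<bar> \<le> \<bar>c2\<bar> * (128 * P)"
    by (simp add: abs_mult mult_left_mono)
  have "\<bar>(bdiff ^^ j) (adjsum (upsample u)) (m + 1)\<bar> \<le> 2 ^ (0 + j) * Q"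
    using abs_bdiff_funpow_refine_le[of j 0 u Q] Q by simp
  also have "\<dots> \<le> 2 ^ 5 * Q"
    using assms(1) nonneg by (intro mult_right_mono power_increasing) auto
  finally have 2: "\<bar>c3 * (bdiff ^^ j) (adjsum (upsample u)) (m + 1)\<bar> \<le> \<bar>c3\<bar> * (32 * Q)"
    by (simp add: abs_mult mult_left_mono)
  have "(bdiff ^^ j) ((adjsum ^^ 7) (upsample u)) = (adjsum ^^ (7 - j)) (upsample ((bdiff ^^ j) u))"
    "(bdiff ^^ j) ((adjsum ^^ 5) (upsample u)) = (adjsum ^^ (5 - j)) (upsample ((bdiff ^^ j) u))"
    using bdiff_funpow_refine[of j "7 - j" u] bdiff_funpow_refine[of j "5 - j" u] assms(1) by simp_all
  with 1 2 show ?thesis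
    unfolding bdiff_funpow_symop by (simp add: algebra_simps)
qed

text \<open>\<open>contr j\<close> is the norm of the stationary limit of the scheme for \<open>j\<close>-th differences, and
  \<open>rate j\<close> a growth factor with \<open>rate j * contr j \<le> 1\<close>; what matters is \<open>rate 5 > 2 ^ 4\<close>.\<close>
definition contr :: "nat \<Rightarrow> real" where
  "contr j = (if j \<le> 4 then 1 / 2 ^ j else 22 / 384)"

definition rate :: "nat \<Rightarrow> real" where
  "rate j = (if j \<le> 4 then 2 ^ j else 384 / 23)"

lemma nat_le_5_cases:
  assumes "(j::nat) \<le> 5"
  obtains "j = 0" | "j = 1" | "j = 2" | "j = 3" | "j = 4" | "j = 5"
  using assms by linarith

lemma symop_bdiff_bound:
  assumes "j \<le> 5"
    and c0: "\<bar>c0 - 1 / 384\<bar> \<le> \<delta>" and c1: "\<bar>c1 - 20 / 384\<bar> \<le> \<delta>"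
    and M: "\<And>m. \<bar>(bdiff ^^ j) u m\<bar> \<le> M"
    and P: "\<And>m. \<bar>(bdiff ^^ (min j 3)) u m\<bar> \<le> P"
    and Q: "\<And>m. \<bar>(bdiff ^^ (min j 1)) u m\<bar> \<le> Q"
  shows "\<bar>(bdiff ^^ j) (symop c0 c1 c2 c3 u) m\<bar>
    \<le> (contr j + 80 * \<delta>) * M + 128 * \<bar>c2\<bar> * P + 32 * \<bar>c3\<bar> * Q"
proof -
  define T where "T n p = (adjsum ^^ n) (upsample ((bdiff ^^ j) u)) p" for n p
  have nonneg: "0 \<le> M" "0 \<le> \<delta>" using M[of 0] c0 by linarith+
  have T: "\<bar>T (Suc n) p\<bar> \<le> 2 ^ n * M" for n p
    unfolding T_def by (rule abs_refine_le) (rule M)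
  \<comment> \<open>Norm bounds of the two main terms: \<open>A = 2 ^ (6 - j)\<close> and
    \<open>B = 2 ^ (4 - j)\<close> when both keep a factor 1 + z. For \<open>j = 5\<close> the
    second term is a bare \<open>upsample\<close>, so \<open>A = 2\<close>, \<open>B = 1\<close> and
    \<open>contr 5 = (2 + 20) / 384\<close>. The sum is largest, 64 + 16 = 80, at
    \<open>j = 0\<close>.\<close>
  have "\<exists>A B. \<bar>T (7 - j) (m + 4)\<bar> \<le> A * M \<and> \<bar>T (5 - j) (m + 3)\<bar> \<le> B * M \<and>
      0 \<le> A \<and> 0 \<le> B \<and> A / 384 + 20 * B / 384 = contr j \<and> A + B \<le> 80"
  proof (cases "j = 5")
    case True
    have "\<bar>T 0 p\<bar> \<le> M" for p
      unfolding T_def using abs_upsample_le[of "(bdiff ^^ j) u" M] M by simp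
    with T[of 1] True show ?thesis
      by (intro exI[of _ 2] exI[of _ 1]) (simp add: contr_def numeral_2_eq_2)
  next
    case False
    with assms(1) have "j \<le> 4" "7 - j = Suc (6 - j)" "5 - j = Suc (4 - j)" by auto
    moreover have "2 ^ (6 - j) / 384 + 20 * 2 ^ (4 - j) / 384 = contr j" "2 ^ (6 - j) + 2 ^ (4 - j) \<le> (80::real)"
      by (rule nat_le_5_cases[OF assms(1)]; use \<open>j \<le> 4\<close> in \<open>simp add: contr_def\<close>)+
    ultimately show ?thesis
      using T by (intro exI[of _ "2 ^ (6 - j)"] exI[of _ "2 ^ (4 - j)"]) auto
  qed
  then obtain A B where AB: "\<bar>T (7 - j) (m + 4)\<bar> \<le> A * M" "\<bar>T (5 - j) (m + 3)\<bar> \<le> B * M"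
      "0 \<le> A" "0 \<le> B" "A / 384 + 20 * B / 384 = contr j" "A + B \<le> 80"
    by blast
  have c: "\<bar>c0\<bar> \<le> 1 / 384 + \<delta>" "\<bar>c1\<bar> \<le> 20 / 384 + \<delta>" using c0 c1 by linarith+
  define E0 E1 E2 where "E0 = c0 * T (7 - j) (m + 4)" and "E1 = c1 * T (5 - j) (m + 3)"
    and "E2 = (bdiff ^^ j) (symop c0 c1 c2 c3 u) m - c0 * T (7 - j) (m + 4) - c1 * T (5 - j) (m + 3)"
  have "\<bar>E0\<bar> \<le> (1 / 384 + \<delta>) * (A * M)"
    unfolding E0_def abs_mult by (rule mult_mono[OF c(1) AB(1)]) (use nonneg in simp_all)
  moreover have "\<bar>E1\<bar> \<le> (20 / 384 + \<delta>) * (B * M)"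
    unfolding E1_def abs_mult by (rule mult_mono[OF c(2) AB(2)]) (use nonneg in simp_all)
  moreover have "\<bar>E2\<bar> \<le> 128 * \<bar>c2\<bar> * P + 32 * \<bar>c3\<bar> * Q"
    unfolding E2_def T_def by (rule symop_principal_part[OF assms(1) P Q])
  ultimately have 1: "\<bar>E0 + E1 + E2\<bar>
      \<le> (1 / 384 + \<delta>) * (A * M) + (20 / 384 + \<delta>) * (B * M) + (128 * \<bar>c2\<bar> * P + 32 * \<bar>c3\<bar> * Q)"
    by (intro order_trans[OF abs_triangle_ineq] add_mono)
  have "(1 / 384 + \<delta>) * (A * M) + (20 / 384 + \<delta>) * (B * M) = contr j * M + (A + B) * (\<delta> * M)"
    unfolding AB(5)[symmetric] by (simp add: algebra_simps)
  also have "\<dots> \<le> contr j * M + 80 * (\<delta> * M)"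
    using AB(6) nonneg by (intro add_left_mono mult_right_mono) auto
  also have "\<dots> = (contr j + 80 * \<delta>) * M"
    by (simp add: distrib_right)
  finally have "(1 / 384 + \<delta>) * (A * M) + (20 / 384 + \<delta>) * (B * M) \<le> (contr j + 80 * \<delta>) * M" .
  from order_trans[OF 1 add_right_mono[OF this]]
  show ?thesis by (simp add: E0_def E1_def E2_def add.assoc)
qed

text \<open>With the limiting coefficients the two main terms have total weight
  \<open>2 ^ (6 - j) / 384 + 20 * 2 ^ (4 - j) / 384 = 1 / 2 ^ j\<close>, so a j-th difference is its
  parent's divided by \<open>2 ^ j\<close>, up to next-order differences and coefficient
  errors.\<close>

lemma symop_consistency:
  assumes "j \<le> 4"
    and c0: "\<bar>c0 - 1 / 384\<bar> \<le> \<delta>" and c1: "\<bar>c1 - 20 / 384\<bar> \<le> \<delta>"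
    and M: "\<And>m. \<bar>(bdiff ^^ j) u m\<bar> \<le> M"
    and N: "\<And>m. \<bar>(bdiff ^^ Suc j) u m\<bar> \<le> N"
    and P: "\<And>m. \<bar>(bdiff ^^ (min j 3)) u m\<bar> \<le> P"
    and Q: "\<And>m. \<bar>(bdiff ^^ (min j 1)) u m\<bar> \<le> Q"
  shows "\<bar>(bdiff ^^ j) (symop c0 c1 c2 c3 u) m - (bdiff ^^ j) u (m div 2) / 2 ^ j\<bar>
    \<le> 1024 * (1 + \<delta>) * N + 80 * \<delta> * M + 128 * \<bar>c2\<bar> * P + 32 * \<bar>c3\<bar> * Q"
proof -
  define v where "v = (bdiff ^^ j) u"
  define T where "T n p = (adjsum ^^ n) (upsample v) p" for n p
  have nonneg: "0 \<le> M" "0 \<le> \<delta>" "0 \<le> N" using M[of 0] N[of 0] c0 by linarith+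
  have N': "\<bar>bdiff v p\<bar> \<le> N" for p
    using N by (simp add: v_def)
  \<comment> \<open>512 = 384 + 128: here 384 = 6 * 2^6 comes from
    \<open>refine_consistency\<close>, and 128 = 2^6 * 2 from the shift \<open>p\<close>, which
    moves the parent index by at most two.\<close>
  have T: "\<bar>T (Suc n) (m + int p) - 2 ^ n * v (m div 2)\<bar> \<le> 512 * N"
    if "n \<le> 6" "p \<le> 4" for n p
  proof -
    have "\<bar>T (Suc n) (m + int p) - 2 ^ n * v ((m + int p) div 2)\<bar> \<le> real n * 2 ^ n * N"
      unfolding T_def by (rule refine_consistency[OF N'])
    also have "real n * 2 ^ n * N \<le> 6 * 2 ^ 6 * N"
      using that nonneg by (intro mult_right_mono mult_mono power_increasing) auto
    finally have 1: "\<bar>T (Suc n) (m + int p) - 2 ^ n * v ((m + int p) div 2)\<bar> \<le> 384 * N"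
      by simp
    have "0 \<le> (m + int p) div 2 - m div 2" "(m + int p) div 2 - m div 2 \<le> 2"
      using that(2) by presburger+
    then obtain q where q: "q \<le> 2" "(m + int p) div 2 = m div 2 + int q"
      by (metis add.commute diff_add_cancel nonneg_int_cases of_nat_le_iff of_nat_numeral)
    have "\<bar>v ((m + int p) div 2) - v (m div 2)\<bar> \<le> real q * N"
      unfolding q(2) by (rule abs_diff_le_bdiff[OF N'])
    also have "\<dots> \<le> 2 * N" using q(1) nonneg by (intro mult_right_mono) auto
    finally have "2 ^ n * \<bar>v ((m + int p) div 2) - v (m div 2)\<bar> \<le> 2 ^ 6 * (2 * N)"
      using that(1) nonneg by (intro mult_mono power_increasing) auto
    then have "\<bar>2 ^ n * v ((m + int p) div 2) - 2 ^ n * v (m div 2)\<bar> \<le> 128 * N"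
      by (simp add: abs_mult flip: right_diff_distrib)
    with 1 show ?thesis by linarith
  qed
  have T': "\<bar>T (7 - j) (m + 4) - 2 ^ (6 - j) * v (m div 2)\<bar> \<le> 512 * N"
      "\<bar>T (5 - j) (m + 3) - 2 ^ (4 - j) * v (m div 2)\<bar> \<le> 512 * N"
    using T[of "6 - j" 4] T[of "4 - j" 3] assms(1) by (simp_all add: Suc_diff_le flip: Suc_diff_le)
  have c: "\<bar>c0\<bar> \<le> 1 + \<delta>" "\<bar>c1\<bar> \<le> 1 + \<delta>" using c0 c1 by linarith+
  define E0 where "E0 = c0 * (T (7 - j) (m + 4) - 2 ^ (6 - j) * v (m div 2))"
  define E1 where "E1 = c1 * (T (5 - j) (m + 3) - 2 ^ (4 - j) * v (m div 2))"
  define E2 where "E2 = ((c0 - 1 / 384) * 2 ^ (6 - j) + (c1 - 20 / 384) * 2 ^ (4 - j)) * v (m div 2)"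
  define E3 where "E3 = (bdiff ^^ j) (symop c0 c1 c2 c3 u) m - c0 * T (7 - j) (m + 4) - c1 * T (5 - j) (m + 3)"
  have "\<bar>E0\<bar> \<le> (1 + \<delta>) * (512 * N)"
    unfolding E0_def abs_mult by (rule mult_mono[OF c(1) T'(1)]) (use nonneg in simp_all)
  moreover have "\<bar>E1\<bar> \<le> (1 + \<delta>) * (512 * N)"
    unfolding E1_def abs_mult by (rule mult_mono[OF c(2) T'(2)]) (use nonneg in simp_all)
  moreover have "\<bar>E2\<bar> \<le> (80 * \<delta>) * M"
  proof -
    have 1: "\<bar>(c0 - 1 / 384) * 2 ^ (6 - j)\<bar> \<le> \<delta> * 2 ^ 6"
      unfolding abs_mult by (rule mult_mono[OF c0]) (use nonneg power_increasing[of "6 - j" 6 "2::real"] in simp_all)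
    have 2: "\<bar>(c1 - 20 / 384) * 2 ^ (4 - j)\<bar> \<le> \<delta> * 2 ^ 4"
      unfolding abs_mult by (rule mult_mono[OF c1]) (use nonneg power_increasing[of "4 - j" 4 "2::real"] in simp_all)
    have "\<bar>(c0 - 1 / 384) * 2 ^ (6 - j) + (c1 - 20 / 384) * 2 ^ (4 - j)\<bar> \<le> 80 * \<delta>"
      by (rule order_trans[OF abs_triangle_ineq order_trans[OF add_mono[OF 1 2]]]) simp
    moreover have "\<bar>v (m div 2)\<bar> \<le> M" "0 \<le> 80 * \<delta>"
      using M nonneg by (simp_all add: v_def)
    ultimately show ?thesis
      unfolding E2_def abs_mult by (rule mult_mono) (rule abs_ge_zero)
  qed
  moreover have "\<bar>E3\<bar> \<le> 128 * \<bar>c2\<bar> * P + 32 * \<bar>c3\<bar> * Q"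
    unfolding E3_def T_def v_def using assms(1) by (intro symop_principal_part P Q) simp
  moreover have "(bdiff ^^ j) (symop c0 c1 c2 c3 u) m - v (m div 2) / 2 ^ j = E0 + E1 + E2 + E3"
  proof -
    have "E2 = c0 * 2 ^ (6 - j) * v (m div 2) + c1 * 2 ^ (4 - j) * v (m div 2) - v (m div 2) / 2 ^ j"
      unfolding E2_def
      by (rule nat_le_5_cases[OF le_trans[OF assms(1), of 5, simplified]]) (use assms(1) in \<open>simp_all add: field_simps\<close>)
    then show ?thesis by (simp add: E0_def E1_def E3_def right_diff_distrib)
  qed
  ultimately have "\<bar>(bdiff ^^ j) (symop c0 c1 c2 c3 u) m - v (m div 2) / 2 ^ j\<bar>
      \<le> (1 + \<delta>) * (512 * N) + (1 + \<delta>) * (512 * N) + (80 * \<delta>) * M + (128 * \<bar>c2\<bar> * P + 32 * \<bar>c3\<bar> * Q)"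
    by (simp only:) (intro order_trans[OF abs_triangle_ineq] add_mono)
  then show ?thesis
    by (simp add: v_def mult_ac)
qed

section \<open>Schemes with an asymptotically stationary symbol\<close>

locale perturbed_scheme =
  fixes c0 c1 c2 c3 :: "nat \<Rightarrow> real" and C :: real
    and f :: "nat \<Rightarrow> int \<Rightarrow> real" and M\<^sub>0 :: real
  assumes c0: "\<And>k. \<bar>c0 k - 1 / 384\<bar> \<le> C / 4 ^ k"
    and c1: "\<And>k. \<bar>c1 k - 20 / 384\<bar> \<le> C / 4 ^ k"
    and c2: "\<And>k. \<bar>c2 k\<bar> \<le> C / 4 ^ k"
    and c3: "\<And>k. \<bar>c3 k\<bar> \<le> C / 16 ^ k"
    and f_0: "\<And>m. \<bar>f 0 m\<bar> \<le> M\<^sub>0"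
    and f_Suc: "\<And>k. f (Suc k) = symop (c0 k) (c1 k) (c2 k) (c3 k) (f k)"
begin

lemma C_nonneg: "0 \<le> C"
  using c0[of 0] by simp

text \<open>Scaled by \<open>rate j ^ k\<close>, the j-th differences satisfy the hypotheses of
  \<open>bounded_recursion\<close>. For large \<open>j\<close> the \<open>c2\<close> term brings
  4^-k times third differences of size 8^-k, the \<open>c3\<close> term 16^-k times first
  differences of size 2^-k; both are of order 32^-k, which beats \<open>rate j ^ k\<close>. The
  guards restrict the prior bounds to the orders above 3 and above 1.\<close>

lemma bdiff_bound_step:
  assumes "j \<le> 5" "0 \<le> B"
    and B3: "\<And>k m. 3 < j \<Longrightarrow> \<bar>(bdiff ^^ 3) (f k) m\<bar> \<le> B / 8 ^ k"
    and B1: "\<And>k m. 1 < j \<Longrightarrow> \<bar>(bdiff ^^ 1) (f k) m\<bar> \<le> B / 2 ^ k"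
  obtains B' where "\<And>k m. \<bar>(bdiff ^^ j) (f k) m\<bar> \<le> B' / rate j ^ k"
proof -
  define r where "r = rate j"
  \<comment> \<open>\<open>12 / 23\<close> is \<open>rate 5 / 32\<close>; it also dominates 1/4 and
    1/16, so one geometric rate serves all error terms.\<close>
  have r: "0 < r" "r * contr j \<le> 1" "r / 32 \<le> 12 / 23"
    by (rule nat_le_5_cases[OF assms(1)]; simp add: r_def rate_def contr_def)+
  define w where "w k m = r ^ k * (bdiff ^^ j) (f k) m" for k m
  have *: "\<bar>w (Suc k) m\<bar> \<le> M + r * (240 * C * (1 + B)) * (12 / 23) ^ k * (M + 1)"
    if "0 \<le> M" and M: "\<And>m. \<bar>w k m\<bar> \<le> M" for k M m
  proof -
    define \<delta> where "\<delta> = C / 4 ^ k"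
    define q where "q = (12 / 23 :: real) ^ k"
    have q: "1 / 4 ^ k \<le> q" "1 / 16 ^ k \<le> q" "r ^ k / 32 ^ k \<le> q"
      unfolding q_def
      using power_mono[of "1 / 4" "12 / 23 :: real" k] power_mono[of "1 / 16" "12 / 23 :: real" k]
        power_mono[OF r(3), of k] r(1) by (simp_all add: power_divide)
    \<comment> \<open>If \<open>j\<close> is at most 3 (for \<open>Q\<close>: at most 1), the
      minimum is \<open>j\<close> and \<open>M / r ^ k\<close> is the bound; otherwise the prior
      bound is. The sum serves both cases.\<close>
    define P Q where "P = M / r ^ k + B / 8 ^ k" and "Q = M / r ^ k + B / 2 ^ k"
    have PQ: "0 \<le> B / 8 ^ k" "0 \<le> B / 2 ^ k" "0 \<le> M / r ^ k" "0 \<le> P" "0 \<le> Q"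
      using assms(2) \<open>0 \<le> M\<close> r(1) by (simp_all add: P_def Q_def)
    have M': "\<bar>(bdiff ^^ j) (f k) m\<bar> \<le> M / r ^ k" for m
      using M[of m] r(1) by (simp add: w_def abs_mult field_simps)
    have "\<bar>(bdiff ^^ min j 3) (f k) m\<bar> \<le> P" for m
    proof (cases "3 < j")
      case True
      then show ?thesis using B3[of k m] PQ by (simp add: P_def)
    next
      case False
      then show ?thesis using M'[of m] PQ by (simp add: P_def min_def)
    qed
    moreover have "\<bar>(bdiff ^^ min j 1) (f k) m\<bar> \<le> Q" for m
    proof (cases "1 < j")
      case True
      then show ?thesis using B1[of k m] PQ by (simp add: Q_def)
    next
      case False
      then have "min j 1 = j" by simp
      then show ?thesis using M'[of m] PQ by (simp add: Q_def)
    qed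
    ultimately have "\<bar>(bdiff ^^ j) (f (Suc k)) m\<bar>
        \<le> (contr j + 80 * \<delta>) * (M / r ^ k) + 128 * \<bar>c2 k\<bar> * P + 32 * \<bar>c3 k\<bar> * Q"
      unfolding f_Suc \<delta>_def by (intro symop_bdiff_bound assms(1) c0 c1 M')
    also have "\<dots> \<le> (contr j + 80 * \<delta>) * (M / r ^ k) + 128 * \<delta> * P + 32 * (C / 16 ^ k) * Q"
      unfolding \<delta>_def using c2[of k] c3[of k] PQ
      by (intro add_mono mult_right_mono mult_left_mono order_refl) auto
    finally have "\<bar>w (Suc k) m\<bar> \<le> r ^ Suc k *
        ((contr j + 80 * \<delta>) * (M / r ^ k) + 128 * \<delta> * P + 32 * (C / 16 ^ k) * Q)"
      using r(1) by (simp only: w_def abs_mult) (simp add: mult_left_mono)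
    also have "\<dots> = r * (r ^ k * ((contr j + 80 * \<delta>) * (M / r ^ k)) + r ^ k * (128 * \<delta> * P)
        + r ^ k * (32 * (C / 16 ^ k) * Q))"
      by (simp add: algebra_simps)
    also have "r ^ k * ((contr j + 80 * \<delta>) * (M / r ^ k)) = contr j * M + 80 * (C * M) * (1 / 4 ^ k)"
      using r(1) by (simp add: \<delta>_def field_simps)
    also have "r ^ k * (128 * \<delta> * P) = 128 * (C * M) * (1 / 4 ^ k) + 128 * (C * B) * (r ^ k / 32 ^ k)"
    proof -
      have 32: "(32::real) ^ k = 4 ^ k * 8 ^ k" by (simp flip: power_mult_distrib)
      show ?thesis unfolding 32 \<delta>_def P_def using r(1) by (simp add: field_simps)
    qed
    also have "r ^ k * (32 * (C / 16 ^ k) * Q) = 32 * (C * M) * (1 / 16 ^ k) + 32 * (C * B) * (r ^ k / 32 ^ k)"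
    proof -
      have 32: "(32::real) ^ k = 16 ^ k * 2 ^ k" by (simp flip: power_mult_distrib)
      show ?thesis unfolding 32 Q_def using r(1) by (simp add: field_simps)
    qed
    also have "r * (contr j * M + 80 * (C * M) * (1 / 4 ^ k)
        + (128 * (C * M) * (1 / 4 ^ k) + 128 * (C * B) * (r ^ k / 32 ^ k))
        + (32 * (C * M) * (1 / 16 ^ k) + 32 * (C * B) * (r ^ k / 32 ^ k)))
      \<le> r * (contr j * M + 80 * (C * M) * q + (128 * (C * M) * q + 128 * (C * B) * q)
        + (32 * (C * M) * q + 32 * (C * B) * q))"
      using r(1) C_nonneg assms(2) \<open>0 \<le> M\<close> by (intro mult_left_mono add_mono q order_refl) auto
    \<comment> \<open>240 = 80 + 128 + 32 collects the coefficients of \<open>M\<close>, and 160 =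
      128 + 32 those of \<open>B\<close>.\<close>
    also have "\<dots> = (r * contr j) * M + r * C * q * (240 * M + 160 * B)"
      by (simp add: algebra_simps)
    also have "\<dots> \<le> 1 * M + r * C * q * (240 * ((1 + B) * (M + 1)))"
    proof (intro add_mono mult_right_mono[OF r(2)] mult_left_mono)
      have "0 \<le> B * M" using assms(2) \<open>0 \<le> M\<close> by simp
      then show "240 * M + 160 * B \<le> 240 * ((1 + B) * (M + 1))"
        using assms(2) by (simp add: algebra_simps)
      show "0 \<le> r * C * q" using r(1) C_nonneg by (simp add: q_def)
    qed fact
    finally show ?thesis by (simp add: q_def algebra_simps)
  qed
  have init: "\<bar>w 0 m\<bar> \<le> 2 ^ j * M\<^sub>0" for m
    unfolding w_def using abs_bdiff_funpow_le[of "f 0", OF f_0] by simp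
  have nonneg: "0 \<le> r * (240 * C * (1 + B))"
    using r(1) C_nonneg assms(2) by simp
  obtain B' where B': "\<And>k m. \<bar>w k m\<bar> \<le> B'"
  proof (rule bounded_recursion[where w = w, OF nonneg _ _ init])
    show "\<bar>w (Suc k) m\<bar> \<le> M + r * (240 * C * (1 + B)) * (12 / 23) ^ k * (M + 1)"
      if "0 \<le> M" "\<And>m. \<bar>w k m\<bar> \<le> M" for k M m
      using that by (rule *)
  qed (simp, simp, blast)
  have "\<bar>(bdiff ^^ j) (f k) m\<bar> \<le> B' / rate j ^ k" for k m
    using B'[of k m] r(1) by (simp add: w_def abs_mult field_simps flip: r_def)
  then show thesis by (rule that)
qed

text \<open>The order matters: first differences need no prior bound, third ones need the first, and
  all orders up to five follow from these two.\<close>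

lemma bdiff_bound:
  obtains B where "0 \<le> B" "\<And>j k m. j \<le> 5 \<Longrightarrow> \<bar>(bdiff ^^ j) (f k) m\<bar> \<le> B / rate j ^ k"
proof -
  obtain B1 where B1: "\<And>k m. \<bar>(bdiff ^^ 1) (f k) m\<bar> \<le> B1 / rate 1 ^ k"
    using bdiff_bound_step[of 1 0] by auto
  then have "0 \<le> B1" using B1[of 0 0] by simp
  then obtain B3 where B3: "\<And>k m. \<bar>(bdiff ^^ 3) (f k) m\<bar> \<le> B3 / rate 3 ^ k"
    using bdiff_bound_step[of 3 B1] B1 by (auto simp: rate_def)
  then have "0 \<le> B3" using B3[of 0 0] by simp
  have "\<exists>B. \<forall>k m. \<bar>(bdiff ^^ j) (f k) m\<bar> \<le> B / rate j ^ k" if "j \<le> 5" for j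
  proof -
    have "\<bar>(bdiff ^^ 3) (f k) m\<bar> \<le> (B1 + B3) / 8 ^ k" "\<bar>(bdiff ^^ 1) (f k) m\<bar> \<le> (B1 + B3) / 2 ^ k" for k m
      using B1[of k m] B3[of k m] divide_right_mono[of B1 "B1 + B3" "2 ^ k"] divide_right_mono[of B3 "B1 + B3" "8 ^ k"]
        \<open>0 \<le> B1\<close> \<open>0 \<le> B3\<close>
      by (auto simp: rate_def)
    with bdiff_bound_step[of j "B1 + B3"] that \<open>0 \<le> B1\<close> \<open>0 \<le> B3\<close> show ?thesis
      by (metis add_nonneg_nonneg)
  qed
  then obtain b where b: "\<And>j k m. j \<le> 5 \<Longrightarrow> \<bar>(bdiff ^^ j) (f k) m\<bar> \<le> b j / rate j ^ k"
    by metis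
  define B where "B = (\<Sum>j\<le>5. \<bar>b j\<bar>)"
  have "\<bar>(bdiff ^^ j) (f k) m\<bar> \<le> B / rate j ^ k" if "j \<le> 5" for j k m
  proof -
    have "b j \<le> \<bar>b j\<bar>" by simp
    also have "\<dots> \<le> B" unfolding B_def using that by (intro member_le_sum) auto
    finally have "b j \<le> B" .
    then have "b j / rate j ^ k \<le> B / rate j ^ k"
      by (intro divide_right_mono) (auto simp: rate_def)
    with b[OF that] show ?thesis by (rule order_trans)
  qed
  moreover have "0 \<le> B" by (simp add: B_def sum_nonneg)
  ultimately show thesis using that by blast
qed

text \<open>The function \<open>g\<close> obtained for \<open>j\<close> will be the \<open>j\<close>-th derivative of the limit function.\<close>
lemma divided_difference_limit:
  obtains K where "\<And>j. j \<le> 4 \<Longrightarrow> \<exists>g. continuous_on UNIV g \<and>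
    (\<forall>k i. \<bar>2 ^ (j * k) * (bdiff ^^ j) (f k) i - g (real_of_int i / 2 ^ k)\<bar> \<le> K * (23 / 24) ^ k)"
proof -
  obtain B where "0 \<le> B" and B: "\<And>j k m. j \<le> 5 \<Longrightarrow> \<bar>(bdiff ^^ j) (f k) m\<bar> \<le> B / rate j ^ k"
    by (rule bdiff_bound) blast
  \<comment> \<open>The factor 16 bounds the \<open>2 ^ j\<close> by which the scaling grows from
    level \<open>k\<close> to \<open>Suc k\<close>.\<close>
  define K where "K = 16 * ((1024 * (1 + C) + 240 * C) * B)"
  have "\<exists>g. continuous_on UNIV g \<and>
      (\<forall>k i. \<bar>2 ^ (j * k) * (bdiff ^^ j) (f k) i - g (real_of_int i / 2 ^ k)\<bar> \<le> K / (1 - 23 / 24) * (23 / 24) ^ k)"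
    if "j \<le> 4" for j
  proof -
    define w where "w k m = 2 ^ (j * k) * (bdiff ^^ j) (f k) m" for k m
    \<comment> \<open>The critical ratio is \<open>2 ^ 4 / rate 5 = 23 / 24\<close>, where fourth
      differences meet fifth ones; all the other ratios used below are at most 1/2.\<close>
    have ratio: "2 ^ (j * k) * (B / rate l ^ k) * (1 / p ^ k) \<le> B * (23 / 24) ^ k"
      if "2 ^ j / (rate l * p) \<le> 23 / 24" "0 < p" for l k and p :: real
    proof -
      have "(2 ^ j / (rate l * p)) ^ k \<le> (23 / 24) ^ k"
        using that by (intro power_mono) (auto simp: rate_def)
      then have "B * (2 ^ j / (rate l * p)) ^ k \<le> B * (23 / 24) ^ k"
        using \<open>0 \<le> B\<close> by (rule mult_left_mono)
      then show ?thesis by (simp add: power_mult power_divide power_mult_distrib mult_ac)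
    qed
    have N: "2 ^ (j * k) * (B / rate (Suc j) ^ k) \<le> B * (23 / 24) ^ k" for k
      using ratio[of "Suc j" 1 k] that
      by (rule_tac nat_le_5_cases[of j]) (auto simp: rate_def)
    have refine: "\<bar>w (Suc k) m - w k (m div 2)\<bar> \<le> K * (23 / 24) ^ k" for k m
    proof -
      define \<delta> where "\<delta> = C / 4 ^ k"
      have \<delta>: "0 \<le> \<delta>" "\<delta> \<le> C"
        using C_nonneg by (simp_all add: \<delta>_def divide_le_eq mult_left_le_one_le mult_le_cancel_left1)
      let ?M = "\<lambda>l. B / rate l ^ k" and ?q = "(23 / 24 :: real) ^ k"
      have M_nonneg: "0 \<le> ?M l" for l
        using \<open>0 \<le> B\<close> by (simp add: rate_def)
      have "\<bar>(bdiff ^^ j) (f (Suc k)) m - (bdiff ^^ j) (f k) (m div 2) / 2 ^ j\<bar>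
          \<le> 1024 * (1 + \<delta>) * ?M (Suc j) + 80 * \<delta> * ?M j + 128 * \<bar>c2 k\<bar> * ?M (min j 3)
            + 32 * \<bar>c3 k\<bar> * ?M (min j 1)"
        unfolding f_Suc \<delta>_def using that by (intro symop_consistency c0 c1 B) auto
      also have "\<dots> \<le> 1024 * (1 + C) * ?M (Suc j) + 80 * \<delta> * ?M j + 128 * \<delta> * ?M (min j 3)
            + 32 * (C / 16 ^ k) * ?M (min j 1)"
        using c2[of k] c3[of k] \<delta> M_nonneg unfolding \<delta>_def
        by (intro add_mono mult_right_mono mult_left_mono order_refl) auto
      finally have "2 ^ (j * k) * \<bar>(bdiff ^^ j) (f (Suc k)) m - (bdiff ^^ j) (f k) (m div 2) / 2 ^ j\<bar>
          \<le> 2 ^ (j * k) * (1024 * (1 + C) * ?M (Suc j) + 80 * \<delta> * ?M j + 128 * \<delta> * ?M (min j 3)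
            + 32 * (C / 16 ^ k) * ?M (min j 1))"
        by (rule mult_left_mono) simp
      also have "\<dots> = 1024 * (1 + C) * (2 ^ (j * k) * ?M (Suc j))
          + 80 * C * (2 ^ (j * k) * ?M j * (1 / 4 ^ k))
          + 128 * C * (2 ^ (j * k) * ?M (min j 3) * (1 / 4 ^ k))
          + 32 * C * (2 ^ (j * k) * ?M (min j 1) * (1 / 16 ^ k))"
        by (simp add: \<delta>_def distrib_left mult_ac)
      also have "\<dots> \<le> 1024 * (1 + C) * (B * ?q) + 80 * C * (B * ?q) + 128 * C * (B * ?q) + 32 * C * (B * ?q)"
      proof (intro add_mono mult_left_mono N ratio)
        show "2 ^ j / (rate j * 4) \<le> 23 / 24"
          using that by (simp add: rate_def)
        show "2 ^ j / (rate (min j 3) * 4) \<le> 23 / 24"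
          using that by (rule_tac nat_le_5_cases[of j]) (auto simp: rate_def)
        show "2 ^ j / (rate (min j 1) * 16) \<le> 23 / 24"
          using that by (rule_tac nat_le_5_cases[of j]) (auto simp: rate_def)
      qed (use C_nonneg in auto)
      also have "\<dots> = ((1024 * (1 + C) + 240 * C) * B) * ?q"
        by (simp add: algebra_simps)
      finally have "2 ^ j * (2 ^ (j * k) * \<bar>(bdiff ^^ j) (f (Suc k)) m - (bdiff ^^ j) (f k) (m div 2) / 2 ^ j\<bar>)
          \<le> 2 ^ j * (((1024 * (1 + C) + 240 * C) * B) * ?q)"
        by (rule mult_left_mono) simp
      also have "\<dots> \<le> 2 ^ 4 * (((1024 * (1 + C) + 240 * C) * B) * ?q)"
        using that C_nonneg \<open>0 \<le> B\<close> by (intro mult_right_mono power_increasing) auto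
      also have "2 ^ j * (2 ^ (j * k) * \<bar>(bdiff ^^ j) (f (Suc k)) m - (bdiff ^^ j) (f k) (m div 2) / 2 ^ j\<bar>)
          = \<bar>2 ^ j * (2 ^ (j * k) * ((bdiff ^^ j) (f (Suc k)) m - (bdiff ^^ j) (f k) (m div 2) / 2 ^ j))\<bar>"
        by (simp add: abs_mult)
      also have "2 ^ j * (2 ^ (j * k) * ((bdiff ^^ j) (f (Suc k)) m - (bdiff ^^ j) (f k) (m div 2) / 2 ^ j))
          = w (Suc k) m - w k (m div 2)"
        by (simp add: w_def power_add right_diff_distrib)
      finally show ?thesis by (simp add: K_def algebra_simps)
    qed
    have neighbour: "\<bar>w k m - w k (m - 1)\<bar> \<le> K * (23 / 24) ^ k" for k m
    proof -
      have "w k m - w k (m - 1) = 2 ^ (j * k) * (bdiff ^^ Suc j) (f k) m"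
        by (simp add: w_def bdiff_def right_diff_distrib)
      then have "\<bar>w k m - w k (m - 1)\<bar> \<le> 2 ^ (j * k) * (B / rate (Suc j) ^ k)"
        using mult_left_mono[OF B[of "Suc j" k m], of "2 ^ (j * k)"] that
        by (simp add: abs_mult del: funpow.simps)
      also have "\<dots> \<le> B * (23 / 24) ^ k" by (rule N)
      also have "\<dots> \<le> K * (23 / 24) ^ k"
        using \<open>0 \<le> B\<close> C_nonneg by (intro mult_right_mono) (auto simp: K_def algebra_simps)
      finally show ?thesis .
    qed
    obtain g where "continuous_on UNIV g"
      "\<And>k i. \<bar>w k i - g (real_of_int i / 2 ^ k)\<bar> \<le> K / (1 - 23 / 24) * (23 / 24) ^ k"
      using dyadic_limit[OF _ _ refine neighbour] by auto
    then show ?thesis unfolding w_def by blast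
  qed
  then show thesis by (rule that)
qed

lemma smooth_limit:
  obtains g K where "C_class 4 g"
    "\<And>k i. \<bar>f k i - g (real_of_int i / 2 ^ k)\<bar> \<le> K * (23 / 24) ^ k"
proof -
  obtain K where "\<And>j. j \<le> 4 \<Longrightarrow> \<exists>g. continuous_on UNIV g \<and>
    (\<forall>k i. \<bar>2 ^ (j * k) * (bdiff ^^ j) (f k) i - g (real_of_int i / 2 ^ k)\<bar> \<le> K * (23 / 24) ^ k)"
    by (rule divided_difference_limit) blast
  then obtain G where cont: "\<And>j. j \<le> 4 \<Longrightarrow> continuous_on UNIV (G j)"
    and G: "\<And>j k i. j \<le> 4 \<Longrightarrow>
      \<bar>2 ^ (j * k) * (bdiff ^^ j) (f k) i - G j (real_of_int i / 2 ^ k)\<bar> \<le> K * (23 / 24) ^ k"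
    by metis
  have lim: "(\<lambda>k. K * (23 / 24) ^ k) \<longlonglongrightarrow> 0"
    by (intro tendsto_mult_right_zero LIMSEQ_realpow_zero) auto
  have "(G j has_real_derivative G (Suc j) y) (at y)" if "j < 4" for j y
  proof (rule dyadic_limit_deriv[OF _ _ lim lim])
    fix k i
    have "2 ^ k * (2 ^ (j * k) * (bdiff ^^ j) (f k) i - 2 ^ (j * k) * (bdiff ^^ j) (f k) (i - 1))
        = 2 ^ (Suc j * k) * (bdiff ^^ Suc j) (f k) i"
      by (simp add: bdiff_def power_add algebra_simps)
    with G[of "Suc j" k i] that
    show "\<bar>2 ^ k * (2 ^ (j * k) * (bdiff ^^ j) (f k) i - 2 ^ (j * k) * (bdiff ^^ j) (f k) (i - 1))
        - G (Suc j) (real_of_int i / 2 ^ k)\<bar> \<le> K * (23 / 24) ^ k"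
      by simp
  qed (use that cont G in auto)
  then have "C_class 4 (G 0)"
    by (rule C_class_chain) (use cont in auto)
  moreover have "\<bar>f k i - G 0 (real_of_int i / 2 ^ k)\<bar> \<le> K * (23 / 24) ^ k" for k i
    using G[of 0 k i] by simp
  ultimately show thesis by (rule that)
qed

end

section \<open>The trigonometric mask\<close>

text \<open>The O-estimate speaks only of x near 0, that is of large \<open>k\<close>; an eventually
  bounded sequence is bounded, which covers the finitely many small \<open>k\<close>.\<close>

lemma bigo_at_dyadic_points:
  fixes h :: "real \<Rightarrow> real"
  assumes "0 < \<alpha>" and "h \<in> O[at_right 0](\<lambda>x. x ^ p)"
  obtains C where "0 \<le> C" "\<And>k. \<bar>h (\<alpha> / 2 ^ (k + 2))\<bar> \<le> C / (2 ^ p) ^ k"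
proof -
  have lim: "filterlim (\<lambda>k. \<alpha> / 2 ^ (k + 2)) (at_right 0) sequentially"
    using assms(1) by real_asymp
  obtain c where c: "\<forall>\<^sub>F x in at_right 0. norm (h x) \<le> c * norm (x ^ p)"
    using landau_o.bigE[OF assms(2)] by blast
  have "\<forall>\<^sub>F k in sequentially. norm (h (\<alpha> / 2 ^ (k + 2)) * (2 ^ p) ^ k) \<le> c * (\<alpha> / 4) ^ p"
  proof (rule eventually_mono[OF eventually_compose_filterlim[OF c lim]])
    fix k
    assume "norm (h (\<alpha> / 2 ^ (k + 2))) \<le> c * norm ((\<alpha> / 2 ^ (k + 2)) ^ p)"
    also have "norm ((\<alpha> / 2 ^ (k + 2)) ^ p) = (\<alpha> / 4) ^ p / (2 ^ p) ^ k"
      using assms(1) by (simp add: power_divide power_mult_distrib abs_mult power_commutes flip: power_mult)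
    finally show "norm (h (\<alpha> / 2 ^ (k + 2)) * (2 ^ p) ^ k) \<le> c * (\<alpha> / 4) ^ p"
      by (simp add: abs_mult field_simps)
  qed
  then have "Bseq (\<lambda>k. h (\<alpha> / 2 ^ (k + 2)) * (2 ^ p) ^ k)"
    by (rule BfunI)
  then obtain C where "0 < C" "\<And>k. norm (h (\<alpha> / 2 ^ (k + 2)) * (2 ^ p) ^ k) \<le> C"
    by (auto elim!: BseqE)
  then show thesis
    by (intro that[of C]) (auto simp: abs_mult field_simps)
qed

text \<open>In terms of x = \<alpha> / 2^(k + 2) all sines of the mask have integer multiples of x
  as arguments, so that Taylor expansion at 0 applies. \<open>den x\<close> behaves like 4 * 8 * 12
  x^3 = 384 x^3, the source of the number 384.\<close>

definition den :: "real \<Rightarrow> real" where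
  "den x = sin (4 * x) * sin (8 * x) * sin (12 * x)"

definition A0 :: "real \<Rightarrow> real" where "A0 x = sin x ^ 3 / den x"

definition A1 :: "real \<Rightarrow> real" where
  "A1 x = (sin (3 * x) * sin (5 * x) ^ 2 + sin x * sin (5 * x) * sin (7 * x) + sin x ^ 2 * sin (11 * x)) / den x"

definition A2 :: "real \<Rightarrow> real" where
  "A2 x = (sin (3 * x) ^ 2 * sin (9 * x) + sin (3 * x) * sin (5 * x) * sin (7 * x) + sin x * sin (7 * x) ^ 2) / den x"

definition A3 :: "real \<Rightarrow> real" where "A3 x = sin (3 * x) ^ 3 / den x"

lemma mask_eq:
  "a0 \<alpha> k = A0 (\<alpha> / 2 ^ (k + 2))" "a1 \<alpha> k = A1 (\<alpha> / 2 ^ (k + 2))"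
  "a2 \<alpha> k = A2 (\<alpha> / 2 ^ (k + 2))" "a3 \<alpha> k = A3 (\<alpha> / 2 ^ (k + 2))"
proof -
  have "den (\<alpha> / 2 ^ (k + 2)) = D \<alpha> k"
    by (simp add: den_def D_def field_simps)
  then show "a0 \<alpha> k = A0 (\<alpha> / 2 ^ (k + 2))" "a1 \<alpha> k = A1 (\<alpha> / 2 ^ (k + 2))"
    "a2 \<alpha> k = A2 (\<alpha> / 2 ^ (k + 2))" "a3 \<alpha> k = A3 (\<alpha> / 2 ^ (k + 2))"
    by (simp_all only: a0_def a1_def a2_def a3_def A0_def A1_def A2_def A3_def times_divide_eq_right)
qed

text \<open>As x tends to 0, \<open>A0\<close>, \<open>A3\<close>, \<open>A1\<close>,
  \<open>A2\<close> tend to 1, 27, 121, 235 over 384, so the combinations have the limits 1/384,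
  20/384, 0, 0. All are even in x, which gives order x^2; in the last one the x^2 term cancels as
  well.\<close>

lemma mask_bigo:
  "(\<lambda>x. A0 x - 1 / 384) \<in> O[at_right 0](\<lambda>x. x ^ 2)"
  "(\<lambda>x. A3 x - 7 * A0 x - 20 / 384) \<in> O[at_right 0](\<lambda>x. x ^ 2)"
  "(\<lambda>x. A1 x - 5 * A3 x + 14 * A0 x) \<in> O[at_right 0](\<lambda>x. x ^ 2)"
  "(\<lambda>x. A2 x - 3 * A1 x + 5 * A3 x - 7 * A0 x) \<in> O[at_right 0](\<lambda>x. x ^ 4)"
  unfolding A0_def A1_def A2_def A3_def den_def by real_asymp+

lemma mask_bounds:
  assumes "0 < \<alpha>"
  obtains C where "0 \<le> C"
    "\<And>k. \<bar>a0 \<alpha> k - 1 / 384\<bar> \<le> C / 4 ^ k"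
    "\<And>k. \<bar>a3 \<alpha> k - 7 * a0 \<alpha> k - 20 / 384\<bar> \<le> C / 4 ^ k"
    "\<And>k. \<bar>a1 \<alpha> k - 5 * a3 \<alpha> k + 14 * a0 \<alpha> k\<bar> \<le> C / 4 ^ k"
    "\<And>k. \<bar>a2 \<alpha> k - 3 * a1 \<alpha> k + 5 * a3 \<alpha> k - 7 * a0 \<alpha> k\<bar> \<le> C / 16 ^ k"
proof -
  obtain C0 where C0: "0 \<le> C0" "\<And>k. \<bar>a0 \<alpha> k - 1 / 384\<bar> \<le> C0 / 4 ^ k"
    by (rule bigo_at_dyadic_points[OF assms mask_bigo(1)]) (simp add: mask_eq)
  obtain C1 where C1: "0 \<le> C1" "\<And>k. \<bar>a3 \<alpha> k - 7 * a0 \<alpha> k - 20 / 384\<bar> \<le> C1 / 4 ^ k"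
    by (rule bigo_at_dyadic_points[OF assms mask_bigo(2)]) (simp add: mask_eq)
  obtain C2 where C2: "0 \<le> C2" "\<And>k. \<bar>a1 \<alpha> k - 5 * a3 \<alpha> k + 14 * a0 \<alpha> k\<bar> \<le> C2 / 4 ^ k"
    by (rule bigo_at_dyadic_points[OF assms mask_bigo(3)]) (simp add: mask_eq)
  obtain C3 where C3: "0 \<le> C3"
    "\<And>k. \<bar>a2 \<alpha> k - 3 * a1 \<alpha> k + 5 * a3 \<alpha> k - 7 * a0 \<alpha> k\<bar> \<le> C3 / 16 ^ k"
    by (rule bigo_at_dyadic_points[OF assms mask_bigo(4)]) (simp add: mask_eq)
  define C where "C = C0 + C1 + C2 + C3"
  have C: "0 \<le> C" "C0 \<le> C" "C1 \<le> C" "C2 \<le> C" "C3 \<le> C"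
    using C0(1) C1(1) C2(1) C3(1) by (auto simp: C_def)
  show thesis
    by (rule that[of C])
      (rule C(1) order_trans[OF C0(2)] order_trans[OF C1(2)] order_trans[OF C2(2)] order_trans[OF C3(2)]
        divide_right_mono C zero_le_power zero_le_numeral)+
qed

section \<open>Convergence and nontriviality of the four-point scheme\<close>

lemma four_point_scheme_smooth_limit:
  assumes "0 < \<alpha>" "bounded (range f0)"
  obtains g K where "C_class 4 g"
    "\<And>k i. \<bar>subdiv (four_point_scheme \<alpha>) f0 k i - g (real_of_int i / 2 ^ k)\<bar> \<le> K * (23 / 24) ^ k"
proof -
  obtain M where M: "\<And>m. \<bar>f0 m\<bar> \<le> M"
    using assms(2) by (auto simp: bounded_iff)
  obtain C where "0 \<le> C"
    and C: "\<And>k. \<bar>a0 \<alpha> k - 1 / 384\<bar> \<le> C / 4 ^ k"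
    "\<And>k. \<bar>a3 \<alpha> k - 7 * a0 \<alpha> k - 20 / 384\<bar> \<le> C / 4 ^ k"
    "\<And>k. \<bar>a1 \<alpha> k - 5 * a3 \<alpha> k + 14 * a0 \<alpha> k\<bar> \<le> C / 4 ^ k"
    "\<And>k. \<bar>a2 \<alpha> k - 3 * a1 \<alpha> k + 5 * a3 \<alpha> k - 7 * a0 \<alpha> k\<bar> \<le> C / 16 ^ k"
    by (rule mask_bounds[OF assms(1)]) blast
  interpret perturbed_scheme "a0 \<alpha>" "\<lambda>k. a3 \<alpha> k - 7 * a0 \<alpha> k"
    "\<lambda>k. a1 \<alpha> k - 5 * a3 \<alpha> k + 14 * a0 \<alpha> k" "\<lambda>k. a2 \<alpha> k - 3 * a1 \<alpha> k + 5 * a3 \<alpha> k - 7 * a0 \<alpha> k"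
    C "subdiv (four_point_scheme \<alpha>) f0" M
    by unfold_locales (use C M in \<open>simp_all add: four_point_scheme_eq_symop\<close>)
  show thesis by (rule smooth_limit) (rule that)
qed

lemma subdiv_limitI:
  assumes "\<And>k i. \<bar>subdiv S f0 k i - g (real_of_int i / 2 ^ k)\<bar> \<le> e k" and "e \<longlonglongrightarrow> 0"
  shows "subdiv_limit S f0 g"
  unfolding subdiv_limit_def
proof (rule tendsto_sandwich)
  show "\<forall>\<^sub>F k in sequentially. 0 \<le> (SUP i::int. ereal \<bar>subdiv S f0 k i - g (real_of_int i / 2 ^ k)\<bar>)"
    by (intro always_eventually allI SUP_upper2[of 0]) auto
  show "\<forall>\<^sub>F k in sequentially. (SUP i::int. ereal \<bar>subdiv S f0 k i - g (real_of_int i / 2 ^ k)\<bar>) \<le> ereal (e k)"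
    by (intro always_eventually allI SUP_least) (simp add: assms(1))
  show "(\<lambda>k. ereal (e k)) \<longlonglongrightarrow> 0"
    using assms(2) by (simp add: zero_ereal_def)
qed simp

lemma four_point_scheme_const:
  "four_point_scheme \<alpha> k (\<lambda>_. c) = (\<lambda>_. c * (a0 \<alpha> k + a1 \<alpha> k + a2 \<alpha> k + a3 \<alpha> k))"
  by (simp add: four_point_scheme_def fun_eq_iff algebra_simps)

lemma subdiv_const:
  "subdiv (four_point_scheme \<alpha>) (\<lambda>_. 1) k = (\<lambda>_. \<Prod>i<k. a0 \<alpha> i + a1 \<alpha> i + a2 \<alpha> i + a3 \<alpha> i)"
  by (induction k) (simp_all add: four_point_scheme_const)

text \<open>Here \<alpha> < pi / 3 enters: the largest argument is 12 x \<le> 3 \<alpha> < pi, so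
  all sines are positive.\<close>

lemma mask_sum_pos:
  assumes "0 < \<alpha>" "\<alpha> < pi / 3"
  shows "0 < a0 \<alpha> k + a1 \<alpha> k + a2 \<alpha> k + a3 \<alpha> k"
proof -
  define x where "x = \<alpha> / 2 ^ (k + 2)"
  have "x \<le> \<alpha> / 4"
    unfolding x_def using assms(1) by (intro divide_left_mono) (auto simp: power_add)
  then have "0 < x" "12 * x < pi" using assms by (auto simp: x_def)
  then have s: "0 < sin (c * x)" if "0 < c" "c \<le> 12" for c
  proof (intro sin_gt_zero)
    show "c * x < pi" using that \<open>0 < x\<close> \<open>12 * x < pi\<close> mult_right_mono[of c 12 x] by linarith
  qed (use that \<open>0 < x\<close> in simp)
  note s1 = s[of 1, simplified]
  have "0 < den x"
    unfolding den_def by (intro mult_pos_pos s) auto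
  then have "0 < A0 x" "0 < A1 x" "0 < A2 x" "0 < A3 x"
    unfolding A0_def A1_def A2_def A3_def
    by (intro divide_pos_pos add_pos_pos mult_pos_pos zero_less_power s s1; simp)+
  then show ?thesis unfolding mask_eq x_def[symmetric] by (intro add_pos_pos)
qed

lemma mask_sum_prod_nonzero:
  assumes "0 < \<alpha>" "\<alpha> < pi / 3"
  obtains L where "L \<noteq> 0" "(\<lambda>k. \<Prod>i<k. a0 \<alpha> i + a1 \<alpha> i + a2 \<alpha> i + a3 \<alpha> i) \<longlonglongrightarrow> L"
proof -
  define \<sigma> where "\<sigma> i = a0 \<alpha> i + a1 \<alpha> i + a2 \<alpha> i + a3 \<alpha> i" for i
  obtain C where "0 \<le> C"
    and C: "\<And>k. \<bar>a0 \<alpha> k - 1 / 384\<bar> \<le> C / 4 ^ k"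
    "\<And>k. \<bar>a3 \<alpha> k - 7 * a0 \<alpha> k - 20 / 384\<bar> \<le> C / 4 ^ k"
    "\<And>k. \<bar>a1 \<alpha> k - 5 * a3 \<alpha> k + 14 * a0 \<alpha> k\<bar> \<le> C / 4 ^ k"
    "\<And>k. \<bar>a2 \<alpha> k - 3 * a1 \<alpha> k + 5 * a3 \<alpha> k - 7 * a0 \<alpha> k\<bar> \<le> C / 16 ^ k"
    by (rule mask_bounds[OF assms(1)]) blast
  have "\<bar>\<sigma> k - 1\<bar> \<le> 85 * C * (1 / 4) ^ k" for k
  proof -
    have le: "C / 16 ^ k \<le> C / 4 ^ k"
      using \<open>0 \<le> C\<close> by (intro divide_left_mono power_mono) auto
    have combine: "\<bar>64 * e0 + 16 * e1 + 4 * e2 + e3\<bar> \<le> 85 * d"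
      if "\<bar>e0\<bar> \<le> d" "\<bar>e1\<bar> \<le> d" "\<bar>e2\<bar> \<le> d" "\<bar>e3\<bar> \<le> d'" "d' \<le> d" for e0 e1 e2 e3 d d' :: real
      using that by linarith
    \<comment> \<open>Each parity class of z^i (1 + z)^(7 - 2 i) has coefficient sum 64, 16, 4, 1
      for i = 0, 1, 2, 3. The limits contribute 64/384 + 16 * 20/384 = 1, and 85 = 64 + 16 + 4 +
      1.\<close>
    have "\<sigma> k - 1 = 64 * (a0 \<alpha> k - 1 / 384) + 16 * (a3 \<alpha> k - 7 * a0 \<alpha> k - 20 / 384)
        + 4 * (a1 \<alpha> k - 5 * a3 \<alpha> k + 14 * a0 \<alpha> k) + (a2 \<alpha> k - 3 * a1 \<alpha> k + 5 * a3 \<alpha> k - 7 * a0 \<alpha> k)"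
      by (simp add: \<sigma>_def)
    with combine[OF C le] have "\<bar>\<sigma> k - 1\<bar> \<le> 85 * (C / 4 ^ k)"
      by (simp only:)
    then show ?thesis by (simp add: power_divide)
  qed
  moreover have "summable (\<lambda>k. 85 * C * (1 / 4) ^ k)"
    by (rule summable_mult[OF summable_geometric]) simp
  ultimately have "summable (\<lambda>k. norm (\<sigma> k - 1))"
    by (elim summable_comparison_test'[where N = 0]) simp
  then have "convergent_prod \<sigma>"
    by (intro abs_convergent_prod_imp_convergent_prod) (simp add: abs_convergent_prod_conv_summable)
  moreover have "\<sigma> i \<noteq> 0" for i
    using mask_sum_pos[OF assms, of i] by (simp add: \<sigma>_def)
  ultimately have "prodinf \<sigma> \<noteq> 0" "(\<lambda>n. \<Prod>i\<le>n. \<sigma> i) \<longlonglongrightarrow> prodinf \<sigma>"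
    using prodinf_nonzero[of \<sigma>] convergent_prod_LIMSEQ[of \<sigma>] by blast+
  moreover have "(\<lambda>n. \<Prod>i<Suc n. \<sigma> i) = (\<lambda>n. \<Prod>i\<le>n. \<sigma> i)"
    by (simp add: lessThan_Suc_atMost)
  ultimately show thesis
    using that[of "prodinf \<sigma>"] filterlim_sequentially_Suc[of "\<lambda>n. \<Prod>i<n. \<sigma> i"] by (simp add: \<sigma>_def)
qed

theorem theorem5p1p5:
  fixes \<alpha> :: real
  assumes "0 < \<alpha>" and "\<alpha> < pi / 3"
  shows "converges_with_smoothness 4 (four_point_scheme \<alpha>)"
proof -
  let ?S = "four_point_scheme \<alpha>"
  have lim: "(\<lambda>k. K * (23 / 24) ^ k) \<longlonglongrightarrow> 0" for K :: real
    by (intro tendsto_mult_right_zero LIMSEQ_realpow_zero) auto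
  have "\<exists>g. C_class 4 g \<and> subdiv_limit ?S f0 g" if "bounded (range f0)" for f0
    using four_point_scheme_smooth_limit[OF assms(1) that] subdiv_limitI[OF _ lim] by metis
  moreover have "\<exists>f0 g. bounded (range f0) \<and> C_class 4 g \<and> subdiv_limit ?S f0 g \<and> (\<exists>x. g x \<noteq> 0)"
  proof -
    have bounded: "bounded (range (\<lambda>_::int. 1::real))" by simp
    obtain g K where "C_class 4 g"
      and g: "\<And>k i. \<bar>subdiv ?S (\<lambda>_. 1) k i - g (real_of_int i / 2 ^ k)\<bar> \<le> K * (23 / 24) ^ k"
      by (rule four_point_scheme_smooth_limit[OF assms(1) bounded]) blast
    \<comment> \<open>Index 0 sits over the point 0 at every level, so this sequence also tends to
      \<open>g 0\<close>.\<close>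
    obtain L where "L \<noteq> 0" and L: "(\<lambda>k. subdiv ?S (\<lambda>_. 1) k 0) \<longlonglongrightarrow> L"
      by (rule mask_sum_prod_nonzero[OF assms]) (simp add: subdiv_const)
    have "(\<lambda>k. subdiv ?S (\<lambda>_. 1) k 0 - g 0) \<longlonglongrightarrow> 0"
      by (rule tendsto_0_le[OF lim[of K], of _ 1])
        (use g[of _ 0] in \<open>auto intro!: always_eventually order_trans[OF _ abs_ge_self]\<close>)
    then have "(\<lambda>k. subdiv ?S (\<lambda>_. 1) k 0) \<longlonglongrightarrow> g 0"
      by (simp add: LIM_zero_iff)
    with L have "g 0 = L" by (rule LIMSEQ_unique[symmetric])
    with \<open>L \<noteq> 0\<close> \<open>C_class 4 g\<close> subdiv_limitI[OF g lim] bounded show ?thesis by blast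
  qed
  ultimately show ?thesis
    unfolding converges_with_smoothness_def by blast
qed

end
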